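(* Let $I\subset[n+1]=\{1,\dots,n+1\}$ be a subset of cardinality $2k$. Then the quotient $\mathbb{Q}\langle\mathrm{Perm}_I\rangle/M_I$ is isomorphic to $\widetilde H_{k-1}((K_{A_n})_I;\mathbb{Q})$ as a $\mathbb{Q}$-vector space.
   Context: $K_{A_n}$ is the simplicial complex whose vertices are the nonempty proper subsets of $[n+1]$ and whose simplices are the chains of such subsets under inclusion. For $I\subset[n+1]$ of even cardinality, $(K_{A_n})_I$ is the full subcomplex of $K_{A_n}$ on the vertices $J$ with $|J\cap I|$ odd (for $I=\emptyset$ it is the empty complex, with $\widetilde H_{-1}=\mathbb{Q}$). $\mathrm{Perm}_I$ is the set of permutations of $I$, written $x=(x_1x_2/\cdots/x_{2k-1}x_{2k})$ in one-line notation grouped in blocks of length two, and $\mathbb{Q}\langle\mathrm{Perm}_I\rangle$ is the $\mathbb{Q}$-vector space with basis $\mathrm{Perm}_I$. $M_I$ is its subspace generated by the following elements, for all $x\in\mathrm{Perm}_I$ (entries not displayed are unchanged): (1) $(x_1\cdots/x_{2i-1}x_{2i}/\cdots x_{2k})+(x_1\cdots/x_{2i}x_{2i-1}/\cdots x_{2k})$ for $1\le i\le k$; (2) for $1\le i\le k-1$, $(x_1\cdots/x_{2i-1}x_{2i}/x_{2i+1}x_{2i+2}/\cdots x_{2k})-(x_1\cdots/x_{2i-1}x_{2i+1}/x_{2i}x_{2i+2}/\cdots x_{2k})+(x_1\cdots/x_{2i-1}x_{2i+2}/x_{2i}x_{2i+1}/\cdots x_{2k})+(x_1\cdots/x_{2i}x_{2i+1}/x_{2i-1}x_{2i+2}/\cdots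 x_{2k})-(x_1\cdots/x_{2i}x_{2i+2}/x_{2i-1}x_{2i+1}/\cdots x_{2k})+(x_1\cdots/x_{2i+1}x_{2i+2}/x_{2i-1}x_{2i}/\cdots x_{2k})$. *)

theory Defs
  imports
    "HOL-Algebra.Algebraic_Closure_Type"
    "HOL-Library.Poly_Mapping"
    "HOL-Combinatorics.Multiset_Permutations"
begin

section \<open>Vector spaces over the rationals\<close>

abbreviation rat_field :: "rat ring" where
  "rat_field \<equiv> ring_of_type_algebra"

text \<open>
  Vector spaces are modules over \<^term>\<open>rat_field\<close> in the sense of \<^locale>\<open>module\<close>. The record type
  \<^typ>\<open>('a, 'b) module\<close> also has multiplicative fields, which that locale ignores; they are left
  undefined.
\<close>

definition free_module :: "'a set \<Rightarrow> (rat, 'a \<Rightarrow>\<^sub>0 rat) module" where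
  "free_module S =
    \<lparr>carrier = {c. Poly_Mapping.keys c \<subseteq> S}, monoid.mult = undefined, one = undefined,
     zero = 0, add = (+), module.smult = (\<lambda>a. Poly_Mapping.map ((*) a))\<rparr>"

definition generated_submodule ::
    "('a, 'c) ring_scheme \<Rightarrow> ('a, 'b, 'd) module_scheme \<Rightarrow> 'b set \<Rightarrow> 'b set" where
  "generated_submodule R M G = \<Inter>{N. submodule N R M \<and> G \<subseteq> N}"

text \<open>
  The scalar multiple of a coset \<open>W + u\<close> is \<open>W + a u\<close>. The union over all representatives gives the
  right answer also for \<open>a = 0\<close>, where the pointwise multiple of the coset would be too small.
\<close>

definition quotient_module ::
    "('a, 'b, 'd) module_scheme \<Rightarrow> 'b set \<Rightarrow> ('a, 'b set) module" where
  "quotient_module M W =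
    \<lparr>carrier = a_rcosets\<^bsub>M\<^esub> W, monoid.mult = undefined, one = undefined,
     zero = W, add = set_add M, module.smult = (\<lambda>a A. \<Union>u\<in>A. W +>\<^bsub>M\<^esub> (a \<odot>\<^bsub>M\<^esub> u))\<rparr>"

definition module_isomorphic ::
    "('a, 'e) ring_scheme \<Rightarrow> ('a, 'b, 'c) module_scheme \<Rightarrow> ('a, 'd, 'f) module_scheme \<Rightarrow> bool" where
  "module_isomorphic R M N \<longleftrightarrow>
    (\<exists>\<phi>. bij_betw \<phi> (carrier M) (carrier N) \<and>
      (\<forall>x\<in>carrier M. \<forall>y\<in>carrier M. \<phi> (x \<oplus>\<^bsub>M\<^esub> y) = \<phi> x \<oplus>\<^bsub>N\<^esub> \<phi> y) \<and>
      (\<forall>a\<in>carrier R. \<forall>x\<in>carrier M. \<phi> (a \<odot>\<^bsub>M\<^esub> x) = a \<odot>\<^bsub>N\<^esub> \<phi> x))"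

lemma lookup_map_mult:
  "Poly_Mapping.lookup (Poly_Mapping.map ((*) (a :: rat)) c) x = a * Poly_Mapping.lookup c x"
  by (simp add: Poly_Mapping.map.rep_eq when_def)

lemma module_free_module: "module rat_field (free_module S)"
proof (rule moduleI)
  show "cring rat_field" by (rule cring_from_type_algebra)
  show "abelian_group (free_module S)"
  proof (rule abelian_groupI)
    fix x assume "x \<in> carrier (free_module S)"
    then show "\<exists>y\<in>carrier (free_module S). y \<oplus>\<^bsub>free_module S\<^esub> x = \<zero>\<^bsub>free_module S\<^esub>"
      by (intro bexI[of _ "- x"]) (auto simp: free_module_def)
  next
    fix x y assume "x \<in> carrier (free_module S)" "y \<in> carrier (free_module S)"
    then show "x \<oplus>\<^bsub>free_module S\<^esub> y \<in> carrier (free_module S)"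
      using Poly_Mapping.keys_add[of x y] by (auto simp: free_module_def)
  qed (auto simp: free_module_def algebra_simps)
qed (auto simp: free_module_def ring_of_type_algebra_def in_keys_iff lookup_map_mult lookup_add
       algebra_simps intro!: poly_mapping_eqI)

lemma module_quotient_module:
  assumes "module R M" and "submodule W R M"
  shows "module R (quotient_module M W)"
proof -
  interpret M: module R M by fact
  interpret W: submodule W R M by fact
  have "additive_subgroup W M"
    using W.subgroup_axioms by (rule additive_subgroupI)
  then interpret W: abelian_subgroup W M
    by (rule abelian_subgroupI3[OF _ M.abelian_group_axioms])
  let ?Q = "quotient_module M W"
  have car: "carrier ?Q = {W +>\<^bsub>M\<^esub> u | u. u \<in> carrier M}"
    by (auto simp: quotient_module_def A_RCOSETS_def')
  have add: "(W +>\<^bsub>M\<^esub> u) \<oplus>\<^bsub>?Q\<^esub> (W +>\<^bsub>M\<^esub> v) = W +>\<^bsub>M\<^esub> (u \<oplus>\<^bsub>M\<^esub> v)"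
    if "u \<in> carrier M" "v \<in> carrier M" for u v
    using that by (simp add: quotient_module_def W.a_rcos_sum)
  have zero: "\<zero>\<^bsub>?Q\<^esub> = W +>\<^bsub>M\<^esub> \<zero>\<^bsub>M\<^esub>"
    by (simp add: quotient_module_def W.a_subset)
  have scale: "a \<odot>\<^bsub>?Q\<^esub> (W +>\<^bsub>M\<^esub> u) = W +>\<^bsub>M\<^esub> (a \<odot>\<^bsub>M\<^esub> u)"
    if a: "a \<in> carrier R" and u: "u \<in> carrier M" for a u
  proof -
    have const: "W +>\<^bsub>M\<^esub> (a \<odot>\<^bsub>M\<^esub> v) = W +>\<^bsub>M\<^esub> (a \<odot>\<^bsub>M\<^esub> u)" if v: "v \<in> W +>\<^bsub>M\<^esub> u" for v
    proof -
      obtain w where w: "w \<in> W" "v = w \<oplus>\<^bsub>M\<^esub> u"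
        using v unfolding a_r_coset_def' by blast
      have aw: "a \<odot>\<^bsub>M\<^esub> w \<in> W"
        using a w(1) by (rule W.smult_closed)
      have wM: "w \<in> carrier M"
        using w(1) W.a_subset by (rule rev_subsetD)
      have "W +>\<^bsub>M\<^esub> (a \<odot>\<^bsub>M\<^esub> v) = (W +>\<^bsub>M\<^esub> (a \<odot>\<^bsub>M\<^esub> w)) +>\<^bsub>M\<^esub> (a \<odot>\<^bsub>M\<^esub> u)"
        unfolding w(2) M.smult_r_distr[OF a wM u]
        by (rule M.a_coset_add_assoc[symmetric, OF W.a_subset M.smult_closed[OF a wM] M.smult_closed[OF a u]])
      also have "W +>\<^bsub>M\<^esub> (a \<odot>\<^bsub>M\<^esub> w) = W"
        using aw by (rule W.a_rcos_const)
      finally show ?thesis .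
    qed
    have "a \<odot>\<^bsub>?Q\<^esub> (W +>\<^bsub>M\<^esub> u) = (\<Union>v\<in>W +>\<^bsub>M\<^esub> u. W +>\<^bsub>M\<^esub> (a \<odot>\<^bsub>M\<^esub> v))"
      unfolding quotient_module_def by (simp only: module.simps)
    also have "\<dots> = (\<Union>v\<in>W +>\<^bsub>M\<^esub> u. W +>\<^bsub>M\<^esub> (a \<odot>\<^bsub>M\<^esub> u))"
      by (intro SUP_cong refl const)
    also have "\<dots> = W +>\<^bsub>M\<^esub> (a \<odot>\<^bsub>M\<^esub> u)"
      using W.a_rcos_self[OF u] by blast
    finally show ?thesis .
  qed
  have rep: thesis
    if "A \<in> carrier ?Q" "\<And>u. \<lbrakk>u \<in> carrier M; A = W +>\<^bsub>M\<^esub> u\<rbrakk> \<Longrightarrow> thesis" for A thesis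
    using that by (auto simp: car)
  have mem: "W +>\<^bsub>M\<^esub> u \<in> carrier ?Q" if "u \<in> carrier M" for u
    using that by (auto simp: car)
  show ?thesis
  proof (rule moduleI)
    show "cring R" by (rule M.R.cring_axioms)
    show "abelian_group ?Q"
    proof (rule abelian_groupI)
      fix A assume "A \<in> carrier ?Q"
      then obtain u where u: "u \<in> carrier M" "A = W +>\<^bsub>M\<^esub> u" by (rule rep)
      then have "(W +>\<^bsub>M\<^esub> (\<ominus>\<^bsub>M\<^esub> u)) \<oplus>\<^bsub>?Q\<^esub> A = \<zero>\<^bsub>?Q\<^esub>"
        unfolding zero by (simp only: add M.a_inv_closed M.l_neg)
      then show "\<exists>B\<in>carrier ?Q. B \<oplus>\<^bsub>?Q\<^esub> A = \<zero>\<^bsub>?Q\<^esub>"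
        using mem[of "\<ominus>\<^bsub>M\<^esub> u"] u(1) by blast
      show "\<zero>\<^bsub>?Q\<^esub> \<oplus>\<^bsub>?Q\<^esub> A = A"
        unfolding zero u(2) using u(1) by (simp only: add M.zero_closed M.l_zero)
    next
      show "\<zero>\<^bsub>?Q\<^esub> \<in> carrier ?Q"
        unfolding zero by (simp only: mem M.zero_closed)
    next
      fix A B assume "A \<in> carrier ?Q" "B \<in> carrier ?Q"
      then obtain u v where u: "u \<in> carrier M" "A = W +>\<^bsub>M\<^esub> u"
          and v: "v \<in> carrier M" "B = W +>\<^bsub>M\<^esub> v"
        by (metis rep)
      show "A \<oplus>\<^bsub>?Q\<^esub> B \<in> carrier ?Q"
        using u v by (simp only: add mem M.a_closed)
      show "A \<oplus>\<^bsub>?Q\<^esub> B = B \<oplus>\<^bsub>?Q\<^esub> A"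
        using u(1) v(1) unfolding u(2) v(2) by (simp only: add M.a_comm[of u v])
      fix C assume "C \<in> carrier ?Q"
      then obtain w where w: "w \<in> carrier M" "C = W +>\<^bsub>M\<^esub> w" by (rule rep)
      show "(A \<oplus>\<^bsub>?Q\<^esub> B) \<oplus>\<^bsub>?Q\<^esub> C = A \<oplus>\<^bsub>?Q\<^esub> (B \<oplus>\<^bsub>?Q\<^esub> C)"
        using u(1) v(1) w(1) unfolding u(2) v(2) w(2) by (simp only: add M.a_closed M.a_assoc)
    qed
  next
    fix A assume "A \<in> carrier ?Q"
    then obtain u where u: "u \<in> carrier M" "A = W +>\<^bsub>M\<^esub> u" by (rule rep)
    show "\<one>\<^bsub>R\<^esub> \<odot>\<^bsub>?Q\<^esub> A = A"
      using u(1) unfolding u(2) by (simp only: scale M.smult_one M.R.one_closed)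
  next
    fix a A assume a: "a \<in> carrier R" and "A \<in> carrier ?Q"
    then obtain u where u: "u \<in> carrier M" "A = W +>\<^bsub>M\<^esub> u" by (metis rep)
    show "a \<odot>\<^bsub>?Q\<^esub> A \<in> carrier ?Q"
      using a u(1) unfolding u(2) by (simp only: scale mem M.smult_closed)
    {
      fix b assume b: "b \<in> carrier R"
      show "(a \<oplus>\<^bsub>R\<^esub> b) \<odot>\<^bsub>?Q\<^esub> A = a \<odot>\<^bsub>?Q\<^esub> A \<oplus>\<^bsub>?Q\<^esub> b \<odot>\<^bsub>?Q\<^esub> A"
        using a b u(1) unfolding u(2)
        by (simp only: scale add M.smult_l_distr M.smult_closed M.R.a_closed)
      show "(a \<otimes>\<^bsub>R\<^esub> b) \<odot>\<^bsub>?Q\<^esub> A = a \<odot>\<^bsub>?Q\<^esub> (b \<odot>\<^bsub>?Q\<^esub> A)"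
        using a b u(1) unfolding u(2)
        by (simp only: scale M.smult_assoc1 M.smult_closed M.R.m_closed)
    }
    fix B assume "B \<in> carrier ?Q"
    then obtain v where v: "v \<in> carrier M" "B = W +>\<^bsub>M\<^esub> v" by (rule rep)
    show "a \<odot>\<^bsub>?Q\<^esub> (A \<oplus>\<^bsub>?Q\<^esub> B) = a \<odot>\<^bsub>?Q\<^esub> A \<oplus>\<^bsub>?Q\<^esub> a \<odot>\<^bsub>?Q\<^esub> B"
      using a u(1) v(1) unfolding u(2) v(2)
      by (simp only: scale add M.smult_r_distr M.smult_closed M.a_closed)
  qed
qed

section \<open>Reduced simplicial homology\<close>

text \<open>
  A simplicial complex is given by its set of simplices, the empty simplex included. The vertex type
  carries a partial order that is assumed to be total on every simplex and thus orients it; in an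
  order complex this is the given order. The \<open>p\<close>-simplices have \<open>p + 1\<close> vertices, so the empty
  simplex spans the chains of degree \<open>-1\<close> and the homology is reduced.
\<close>

definition simplicial_chains :: "'v set set \<Rightarrow> int \<Rightarrow> (rat, 'v set \<Rightarrow>\<^sub>0 rat) module" where
  "simplicial_chains K p = free_module {\<sigma> \<in> K. int (card \<sigma>) = p + 1}"

text \<open>
  The coefficient of the face opposite to \<open>v\<close> is \<open>(-1)\<^sup>i\<close>, where \<open>i\<close> is the position of \<open>v\<close> in the
  ordered simplex, counted from \<open>0\<close>.
\<close>

definition boundary :: "('v::order set \<Rightarrow>\<^sub>0 rat) \<Rightarrow> ('v set \<Rightarrow>\<^sub>0 rat)" where
  "boundary c = (\<Sum>\<sigma>\<in>Poly_Mapping.keys c. \<Sum>v\<in>\<sigma>.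
     Poly_Mapping.single (\<sigma> - {v}) ((-1) ^ card {w \<in> \<sigma>. w < v} * Poly_Mapping.lookup c \<sigma>))"

definition cycles :: "'v::order set set \<Rightarrow> int \<Rightarrow> ('v set \<Rightarrow>\<^sub>0 rat) set" where
  "cycles K p = {c \<in> carrier (simplicial_chains K p). boundary c = 0}"

definition boundaries :: "'v::order set set \<Rightarrow> int \<Rightarrow> ('v set \<Rightarrow>\<^sub>0 rat) set" where
  "boundaries K p = boundary ` carrier (simplicial_chains K (p + 1))"

definition reduced_homology ::
    "'v::order set set \<Rightarrow> int \<Rightarrow> (rat, ('v set \<Rightarrow>\<^sub>0 rat) set) module" where
  "reduced_homology K p =
    quotient_module ((simplicial_chains K p)\<lparr>carrier := cycles K p\<rparr>) (boundaries K p)"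

section \<open>The complexes\<close>

definition complex_A :: "nat \<Rightarrow> nat set set set" where
  "complex_A n = {\<sigma>. \<sigma> \<subseteq> {J. J \<noteq> {} \<and> J \<subset> {1..n + 1}} \<and> chain_subset \<sigma>}"

definition full_subcomplex :: "'v set set \<Rightarrow> 'v set \<Rightarrow> 'v set set" where
  "full_subcomplex K W = {\<sigma> \<in> K. \<sigma> \<subseteq> W}"

definition complex_A_sub :: "nat \<Rightarrow> nat set \<Rightarrow> nat set set set" where
  "complex_A_sub n I = full_subcomplex (complex_A n) {J. odd (card (J \<inter> I))}"

section \<open>The relations between permutations\<close>

text \<open>
  A permutation of \<open>I\<close> is the list of its entries. The prefix \<open>us\<close> has even length, so that the
  displayed entries fill whole blocks of length two.
\<close>

definition swap_relations :: "nat set \<Rightarrow> (nat list \<Rightarrow>\<^sub>0 rat) set" where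
  "swap_relations I =
    {Poly_Mapping.single (us @ [a, b] @ vs) 1 + Poly_Mapping.single (us @ [b, a] @ vs) 1 | us a b vs.
      us @ [a, b] @ vs \<in> permutations_of_set I \<and> even (length us)}"

definition exchange_relations :: "nat set \<Rightarrow> (nat list \<Rightarrow>\<^sub>0 rat) set" where
  "exchange_relations I =
    {Poly_Mapping.single (us @ [a, b, c, d] @ vs) 1
     - Poly_Mapping.single (us @ [a, c, b, d] @ vs) 1
     + Poly_Mapping.single (us @ [a, d, b, c] @ vs) 1
     + Poly_Mapping.single (us @ [b, c, a, d] @ vs) 1
     - Poly_Mapping.single (us @ [b, d, a, c] @ vs) 1
     + Poly_Mapping.single (us @ [c, d, a, b] @ vs) 1 | us a b c d vs.
      us @ [a, b, c, d] @ vs \<in> permutations_of_set I \<and> even (length us)}"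

definition perm_module :: "nat set \<Rightarrow> (rat, nat list \<Rightarrow>\<^sub>0 rat) module" where
  "perm_module I = free_module (permutations_of_set I)"

definition relation_submodule :: "nat set \<Rightarrow> (nat list \<Rightarrow>\<^sub>0 rat) set" where
  "relation_submodule I =
    generated_submodule rat_field (perm_module I) (swap_relations I \<union> exchange_relations I)"

end

theory Submission
  imports Defs
begin

text \<open>
  Intersecting vertices with \<open>I\<close> deforms \<open>(K\<^sub>A)\<^sub>I\<close> onto the order complex \<open>P\<close> of the subsets of \<open>I\<close>
  of odd cardinality, which has dimension \<open>k - 1\<close>, so that the homology in question is the space of
  top-dimensional cycles of \<open>P\<close>. A permutation \<open>x\<close> gives such a cycle, the join of the \<open>k\<close> zero-spheres
  formed by the two sets \<open>{x\<^sub>1, \<dots>, x\<^sub>2\<^sub>i\<^sub>-\<^sub>2, x\<^sub>2\<^sub>i\<^sub>-\<^sub>1}\<close> and \<open>{x\<^sub>1, \<dots>, x\<^sub>2\<^sub>i\<^sub>-\<^sub>2, x\<^sub>2\<^sub>i}\<close>, and the relations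
  are satisfied. Modulo the relations every permutation is a combination of alternating ones
  \<open>x\<^sub>1 < x\<^sub>2 > x\<^sub>3 < \<dots>\<close>, and the cycles of these are independent: with respect to the sum of all elements
  of all vertices, \<open>{x\<^sub>1} \<subset> {x\<^sub>1, x\<^sub>2, x\<^sub>3} \<subset> \<dots>\<close> is the unique lowest simplex of the cycle of \<open>x\<close>.
  Conversely, the cycle condition forces every lowest simplex of a cycle to arise in this way, so
  that subtracting cycles of permutations reduces any cycle to zero.
\<close>

section \<open>Linear maps on formal linear combinations\<close>

text \<open>What ties the two sides together is that \<open>flag\<close> is a bijection from the
  permutations satisfying \<open>down\<close> to the maximal chains of P. Consecutive sets of such a
  chain differ by two elements, and \<open>down\<close> says that the larger one closes a block
  while the smaller one opens the next. So every candidate for a lowest simplex already carries the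
  name of a permutation, and only \<open>up\<close> remains to be decided for it. The two halves of
  the alternating condition thus have separate tasks: \<open>up\<close> makes the flag the lowest
  simplex of the cycle, \<open>down\<close> makes the permutation readable from the flag. Swap
  relations repair the former, exchange relations the latter. The deformation onto P takes place on
  chains and in two halves. That every class has a representative in P is shown by pushing the
  vertices outside \<open>I\<close> into \<open>I\<close> one at a time. That no nonzero cycle of P
  bounds in the larger complex follows by intersecting with \<open>I\<close>: this map fixes the
  cycle and kills all chains of degree k, a degree in which P has no simplices.\<close>

abbreviation coeff :: "('a \<Rightarrow>\<^sub>0 rat) \<Rightarrow> 'a \<Rightarrow> rat" where
  "coeff \<equiv> Poly_Mapping.lookup"

abbreviation supp :: "('a \<Rightarrow>\<^sub>0 rat) \<Rightarrow> 'a set" where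
  "supp \<equiv> Poly_Mapping.keys"

abbreviation scale :: "rat \<Rightarrow> ('a \<Rightarrow>\<^sub>0 rat) \<Rightarrow> ('a \<Rightarrow>\<^sub>0 rat)" where
  "scale a \<equiv> Poly_Mapping.map ((*) a)"

definition lin_ext :: "('a \<Rightarrow> 'b \<Rightarrow>\<^sub>0 rat) \<Rightarrow> ('a \<Rightarrow>\<^sub>0 rat) \<Rightarrow> ('b \<Rightarrow>\<^sub>0 rat)" where
  "lin_ext f c = (\<Sum>x\<in>supp c. scale (coeff c x) (f x))"

lemma lookup_lin_ext_superset:
  assumes "finite A" "supp c \<subseteq> A"
  shows "coeff (lin_ext f c) y = (\<Sum>x\<in>A. coeff c x * coeff (f x) y)"
proof -
  have "coeff (lin_ext f c) y = (\<Sum>x\<in>supp c. coeff c x * coeff (f x) y)"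
    by (simp add: lin_ext_def lookup_sum lookup_map_mult)
  also have "\<dots> = (\<Sum>x\<in>A. coeff c x * coeff (f x) y)"
    using assms by (intro sum.mono_neutral_left) (auto simp: in_keys_iff)
  finally show ?thesis .
qed

lemma lookup_lin_ext: "coeff (lin_ext f c) y = (\<Sum>x\<in>supp c. coeff c x * coeff (f x) y)"
  by (rule lookup_lin_ext_superset) auto

lemma keys_scale: "supp (scale a c) \<subseteq> supp c"
  by (auto simp: in_keys_iff lookup_map_mult)

lemma scale_1 [simp]: "scale 1 c = c"
  by (auto intro!: poly_mapping_eqI simp: lookup_map_mult)

lemma scale_0 [simp]: "scale 0 c = 0"
  by (auto intro!: poly_mapping_eqI simp: lookup_map_mult)

lemma scale_minus1: "scale (- 1) c = - c"
  by (auto intro!: poly_mapping_eqI simp: lookup_map_mult)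

lemma scale_zero [simp]: "scale a 0 = 0"
  by (auto intro!: poly_mapping_eqI simp: lookup_map_mult)

lemma scale_diff: "scale a (c - d) = scale a c - scale a d"
  by (auto intro!: poly_mapping_eqI simp: lookup_map_mult lookup_minus right_diff_distrib)

lemma scale_sum: "scale a (sum f A) = (\<Sum>x\<in>A. scale a (f x))"
  by (auto intro!: poly_mapping_eqI simp: lookup_map_mult lookup_sum sum_distrib_left)

lemma scale_single: "scale a (Poly_Mapping.single x b) = Poly_Mapping.single x (a * b)"
  by (auto intro!: poly_mapping_eqI simp: lookup_map_mult lookup_single when_def)

lemma lin_ext_add: "lin_ext f (c + d) = lin_ext f c + lin_ext f d"
proof (rule poly_mapping_eqI)
  fix y
  let ?A = "supp c \<union> supp d"
  have "supp (c + d) \<subseteq> ?A" by (rule Poly_Mapping.keys_add)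
  then show "coeff (lin_ext f (c + d)) y = coeff (lin_ext f c + lin_ext f d) y"
    by (simp add: lookup_add lookup_lin_ext_superset[of ?A] distrib_right sum.distrib)
qed

lemma lin_ext_scale: "lin_ext f (scale a c) = scale a (lin_ext f c)"
proof (rule poly_mapping_eqI)
  fix y
  have "coeff (lin_ext f (scale a c)) y = (\<Sum>x\<in>supp c. coeff (scale a c) x * coeff (f x) y)"
    by (intro lookup_lin_ext_superset finite_keys keys_scale)
  then show "coeff (lin_ext f (scale a c)) y = coeff (scale a (lin_ext f c)) y"
    by (simp add: lookup_lin_ext lookup_map_mult sum_distrib_left mult.assoc)
qed

lemma lin_ext_single [simp]: "lin_ext f (Poly_Mapping.single x a) = scale a (f x)"
  by (simp add: lin_ext_def)

lemma lin_ext_0 [simp]: "lin_ext f 0 = 0"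
  by (simp add: lin_ext_def)

lemma lin_ext_minus: "lin_ext f (- c) = - lin_ext f c"
  using lin_ext_scale[of f "- 1" c] by (simp add: scale_minus1)

lemma lin_ext_diff: "lin_ext f (c - d) = lin_ext f c - lin_ext f d"
  using lin_ext_add[of f c "- d"] by (simp add: lin_ext_minus)

lemma lin_ext_sum: "lin_ext f (sum g A) = (\<Sum>x\<in>A. lin_ext f (g x))"
  by (induction A rule: infinite_finite_induct) (auto simp: lin_ext_add)

lemma lin_ext_cong: "(\<And>x. x \<in> supp c \<Longrightarrow> f x = g x) \<Longrightarrow> lin_ext f c = lin_ext g c"
  by (simp add: lin_ext_def)

lemma lin_ext_eq_0: "(\<And>x. x \<in> supp c \<Longrightarrow> f x = 0) \<Longrightarrow> lin_ext f c = 0"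
  by (simp add: lin_ext_def)

lemma lin_ext_lin_ext: "lin_ext g (lin_ext f c) = lin_ext (\<lambda>x. lin_ext g (f x)) c"
  by (simp add: lin_ext_def[of f] lin_ext_def[of "\<lambda>x. lin_ext g (f x)"] lin_ext_sum lin_ext_scale)

lemma lin_ext_single_id: "lin_ext (\<lambda>x. Poly_Mapping.single x 1) c = c"
proof (rule poly_mapping_eqI)
  fix y
  have "coeff (lin_ext (\<lambda>x. Poly_Mapping.single x 1) c) y = (\<Sum>x\<in>supp c. if x = y then coeff c x else 0)"
    unfolding lookup_lin_ext by (intro sum.cong) (auto simp: lookup_single when_def)
  then show "coeff (lin_ext (\<lambda>x. Poly_Mapping.single x 1) c) y = coeff c y"
    by (simp add: in_keys_iff)
qed

lemma keys_lin_ext: "supp (lin_ext f c) \<subseteq> (\<Union>x\<in>supp c. supp (f x))"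
proof
  fix y assume "y \<in> supp (lin_ext f c)"
  then have "(\<Sum>x\<in>supp c. coeff c x * coeff (f x) y) \<noteq> 0"
    by (simp add: in_keys_iff lookup_lin_ext)
  then obtain x where "x \<in> supp c" "coeff c x * coeff (f x) y \<noteq> 0"
    by (meson sum.neutral)
  then show "y \<in> (\<Union>x\<in>supp c. supp (f x))"
    by (auto simp: in_keys_iff)
qed

lemma carrier_free_module: "c \<in> carrier (free_module S) \<longleftrightarrow> supp c \<subseteq> S"
  by (simp add: free_module_def)

lemma carrier_rat_field [simp]: "carrier rat_field = UNIV"
  by (simp add: ring_of_type_algebra_def)

lemma free_module_simps [simp]:
  "add (free_module S) = (+)" "zero (free_module S) = 0"
  "module.smult (free_module S) = scale"
  by (auto simp: free_module_def)

lemma a_inv_free_module: "supp c \<subseteq> S \<Longrightarrow> \<ominus>\<^bsub>free_module S\<^esub> c = - c"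
proof -
  assume c: "supp c \<subseteq> S"
  interpret module rat_field "free_module S" by (rule module_free_module)
  show ?thesis
    by (rule M.minus_equality) (use c in \<open>auto simp: carrier_free_module\<close>)
qed

lemma submodule_free_moduleI:
  assumes "\<And>c. c \<in> N \<Longrightarrow> supp c \<subseteq> S" "0 \<in> N"
    and "\<And>c d. c \<in> N \<Longrightarrow> d \<in> N \<Longrightarrow> c + d \<in> N"
    and "\<And>a c. c \<in> N \<Longrightarrow> scale a c \<in> N"
  shows "submodule N rat_field (free_module S)"
proof -
  interpret module rat_field "free_module S" by (rule module_free_module)
  show ?thesis
  proof (rule submoduleI)
    fix c assume "c \<in> N"
    then show "\<ominus>\<^bsub>free_module S\<^esub> c \<in> N"
      using assms(1)[of c] assms(4)[of c "- 1"] by (simp add: a_inv_free_module scale_minus1)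
  qed (use assms in \<open>auto simp: carrier_free_module\<close>)
qed

section \<open>Isomorphisms of quotient modules\<close>

lemma generated_submodule_incl: "G \<subseteq> generated_submodule R M G"
  by (auto simp: generated_submodule_def)

lemma (in module) submodule_generated:
  assumes "G \<subseteq> carrier M"
  shows "submodule (generated_submodule R M G) R M"
proof -
  \<comment> \<open>The carrier is a member of the intersected family, which keeps the intersection
    inside the module.\<close>
  have *: "submodule (carrier M) R M" by (rule carrier_is_submodule)
  show ?thesis
  proof (rule submoduleI)
    show "generated_submodule R M G \<subseteq> carrier M"
      using * assms by (auto simp: generated_submodule_def)
    show "\<zero>\<^bsub>M\<^esub> \<in> generated_submodule R M G"
      unfolding generated_submodule_def
      by (auto dest!: submodule.axioms(1) dest: subgroup.one_closed)
  qed (auto simp: generated_submodule_def dest: submoduleE)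
qed

lemma
  assumes M: "module R M" and W: "submodule W R M"
  shows carrier_quotient_module: "carrier (quotient_module M W) = {W +>\<^bsub>M\<^esub> u | u. u \<in> carrier M}"
    and rep_in_coset: "u \<in> carrier M \<Longrightarrow> u \<in> W +>\<^bsub>M\<^esub> u"
    and coset_eqI: "u \<in> carrier M \<Longrightarrow> v \<in> W +>\<^bsub>M\<^esub> u \<Longrightarrow> W +>\<^bsub>M\<^esub> v = W +>\<^bsub>M\<^esub> u"
    and coset_eq_iff: "u \<in> carrier M \<Longrightarrow> v \<in> carrier M \<Longrightarrow>
      W +>\<^bsub>M\<^esub> u = W +>\<^bsub>M\<^esub> v \<longleftrightarrow> u \<ominus>\<^bsub>M\<^esub> v \<in> W"
    and add_quotient_module: "u \<in> carrier M \<Longrightarrow> v \<in> carrier M \<Longrightarrow>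
      (W +>\<^bsub>M\<^esub> u) \<oplus>\<^bsub>quotient_module M W\<^esub> (W +>\<^bsub>M\<^esub> v) = W +>\<^bsub>M\<^esub> (u \<oplus>\<^bsub>M\<^esub> v)"
    and smult_quotient_module: "a \<in> carrier R \<Longrightarrow> u \<in> carrier M \<Longrightarrow>
      a \<odot>\<^bsub>quotient_module M W\<^esub> (W +>\<^bsub>M\<^esub> u) = W +>\<^bsub>M\<^esub> (a \<odot>\<^bsub>M\<^esub> u)"
    and coset_carrier: "u \<in> carrier M \<Longrightarrow> v \<in> W +>\<^bsub>M\<^esub> u \<Longrightarrow> v \<in> carrier M"
proof -
  interpret M: module R M by fact
  interpret W: submodule W R M by fact
  have "additive_subgroup W M" using W.subgroup_axioms by (rule additive_subgroupI)
  then interpret W: abelian_subgroup W M by (rule abelian_subgroupI3[OF _ M.abelian_group_axioms])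
  show "carrier (quotient_module M W) = {W +>\<^bsub>M\<^esub> u | u. u \<in> carrier M}"
    by (auto simp: quotient_module_def A_RCOSETS_def')
  show self: "u \<in> W +>\<^bsub>M\<^esub> u" if "u \<in> carrier M" for u
    using that by (rule W.a_rcos_self)
  show car: "v \<in> carrier M" if "u \<in> carrier M" "v \<in> W +>\<^bsub>M\<^esub> u" for u v
    using that by (rule W.a_elemrcos_carrier)
  show eqI: "W +>\<^bsub>M\<^esub> v = W +>\<^bsub>M\<^esub> u" if "u \<in> carrier M" "v \<in> W +>\<^bsub>M\<^esub> u" for u v
    using M.a_repr_independence[OF that(2,1) W.a_subgroup] by simp
  show eq: "W +>\<^bsub>M\<^esub> u = W +>\<^bsub>M\<^esub> v \<longleftrightarrow> u \<ominus>\<^bsub>M\<^esub> v \<in> W" if "u \<in> carrier M" "v \<in> carrier M" for u v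
    using that W.a_rcos_module[of v u] eqI[of v u] self[of u] by (auto simp: a_minus_def)
  show "(W +>\<^bsub>M\<^esub> u) \<oplus>\<^bsub>quotient_module M W\<^esub> (W +>\<^bsub>M\<^esub> v) = W +>\<^bsub>M\<^esub> (u \<oplus>\<^bsub>M\<^esub> v)"
    if "u \<in> carrier M" "v \<in> carrier M" for u v
    using that by (simp add: quotient_module_def W.a_rcos_sum)
  show "a \<odot>\<^bsub>quotient_module M W\<^esub> (W +>\<^bsub>M\<^esub> u) = W +>\<^bsub>M\<^esub> (a \<odot>\<^bsub>M\<^esub> u)"
    if a: "a \<in> carrier R" and u: "u \<in> carrier M" for a u
  proof -
    have "W +>\<^bsub>M\<^esub> (a \<odot>\<^bsub>M\<^esub> v) = W +>\<^bsub>M\<^esub> (a \<odot>\<^bsub>M\<^esub> u)" if v: "v \<in> W +>\<^bsub>M\<^esub> u" for v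
    proof -
      have vM: "v \<in> carrier M" using u v by (rule car)
      have "v \<ominus>\<^bsub>M\<^esub> u \<in> W" using eqI[OF u v] eq[OF vM u] by simp
      then have "a \<odot>\<^bsub>M\<^esub> (v \<ominus>\<^bsub>M\<^esub> u) \<in> W" using a by blast
      then show ?thesis
        using a u vM by (simp add: eq a_minus_def M.smult_r_distr M.smult_r_minus)
    qed
    then have "(\<Union>v\<in>W +>\<^bsub>M\<^esub> u. W +>\<^bsub>M\<^esub> (a \<odot>\<^bsub>M\<^esub> v)) = W +>\<^bsub>M\<^esub> (a \<odot>\<^bsub>M\<^esub> u)"
      using self[OF u] by blast
    then show ?thesis by (simp add: quotient_module_def)
  qed
qed

text \<open>The first isomorphism theorem with surjectivity asked only modulo \<open>B\<close>. This
  is what is available later: a cycle of the complex is merely homologous to the image of a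
  combination of permutations.\<close>

lemma module_isomorphic_quotientI:
  assumes M: "module R M" "submodule W R M" and N: "module R N" "submodule B R N"
    and f: "\<And>u. u \<in> carrier M \<Longrightarrow> f u \<in> carrier N"
      "\<And>u v. u \<in> carrier M \<Longrightarrow> v \<in> carrier M \<Longrightarrow> f (u \<oplus>\<^bsub>M\<^esub> v) = f u \<oplus>\<^bsub>N\<^esub> f v"
      "\<And>a u. a \<in> carrier R \<Longrightarrow> u \<in> carrier M \<Longrightarrow> f (a \<odot>\<^bsub>M\<^esub> u) = a \<odot>\<^bsub>N\<^esub> f u"
    and inj: "\<And>u. u \<in> carrier M \<Longrightarrow> f u \<in> B \<longleftrightarrow> u \<in> W"
    and surj: "\<And>c. c \<in> carrier N \<Longrightarrow> \<exists>u\<in>carrier M. \<exists>b\<in>B. c = b \<oplus>\<^bsub>N\<^esub> f u"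
  shows "module_isomorphic R (quotient_module M W) (quotient_module N B)"
proof -
  interpret M: module R M by fact
  interpret N: module R N by fact
  \<comment> \<open>All terms of this union are the same coset, as \<open>eq\<close> will show, so
    no representative has to be chosen.\<close>
  define \<phi> where "\<phi> A = (\<Union>u\<in>A. B +>\<^bsub>N\<^esub> f u)" for A
  have f_uminus: "f (\<ominus>\<^bsub>M\<^esub> u) = \<ominus>\<^bsub>N\<^esub> f u" if u: "u \<in> carrier M" for u
  proof -
    have "\<ominus>\<^bsub>M\<^esub> u = (\<ominus>\<^bsub>R\<^esub> \<one>\<^bsub>R\<^esub>) \<odot>\<^bsub>M\<^esub> u" using u by (simp add: M.smult_l_minus)
    then show ?thesis using u f(1)[OF u] by (simp add: f(3) N.smult_l_minus)
  qed
  have eq: "B +>\<^bsub>N\<^esub> f u = B +>\<^bsub>N\<^esub> f v \<longleftrightarrow> W +>\<^bsub>M\<^esub> u = W +>\<^bsub>M\<^esub> v" if "u \<in> carrier M" "v \<in> carrier M" for u v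
    using that f(1) inj[of "u \<ominus>\<^bsub>M\<^esub> v"]
    by (simp add: coset_eq_iff[OF M] coset_eq_iff[OF N] f(2) f_uminus a_minus_def)
  have \<phi>: "\<phi> (W +>\<^bsub>M\<^esub> u) = B +>\<^bsub>N\<^esub> f u" if u: "u \<in> carrier M" for u
  proof -
    have "B +>\<^bsub>N\<^esub> f v = B +>\<^bsub>N\<^esub> f u" if v: "v \<in> W +>\<^bsub>M\<^esub> u" for v
      using eq[OF coset_carrier[OF M u v] u] coset_eqI[OF M u v] by simp
    then show ?thesis using rep_in_coset[OF M u] unfolding \<phi>_def by blast
  qed
  note carM = carrier_quotient_module[OF M] and carN = carrier_quotient_module[OF N]
  show ?thesis
    unfolding module_isomorphic_def
  proof (intro exI[of _ \<phi>] conjI ballI)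
    show "bij_betw \<phi> (carrier (quotient_module M W)) (carrier (quotient_module N B))"
      unfolding bij_betw_def
    proof
      show "inj_on \<phi> (carrier (quotient_module M W))"
        by (auto simp: inj_on_def carM \<phi> eq)
      have "A \<in> \<phi> ` carrier (quotient_module M W)" if A: "A \<in> carrier (quotient_module N B)" for A
      proof -
        obtain c where c: "c \<in> carrier N" "A = B +>\<^bsub>N\<^esub> c" using A by (auto simp: carN)
        obtain u b where u: "u \<in> carrier M" and b: "b \<in> B" and cu: "c = b \<oplus>\<^bsub>N\<^esub> f u"
          using surj[OF c(1)] by blast
        have "c \<in> B +>\<^bsub>N\<^esub> f u" using b cu unfolding a_r_coset_def' by blast
        then have "A = \<phi> (W +>\<^bsub>M\<^esub> u)"
          using coset_eqI[OF N f(1)[OF u]] c(2) by (simp add: \<phi>[OF u])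
        then show ?thesis using u by (auto simp: carM)
      qed
      then show "\<phi> ` carrier (quotient_module M W) = carrier (quotient_module N B)"
        using f(1) by (auto simp: carM carN \<phi>)
    qed
  next
    fix A A' assume "A \<in> carrier (quotient_module M W)" "A' \<in> carrier (quotient_module M W)"
    then show "\<phi> (A \<oplus>\<^bsub>quotient_module M W\<^esub> A') = \<phi> A \<oplus>\<^bsub>quotient_module N B\<^esub> \<phi> A'"
      using f(1) by (auto simp: carM add_quotient_module[OF M] add_quotient_module[OF N] \<phi> f(2))
  next
    fix a A assume "a \<in> carrier R" "A \<in> carrier (quotient_module M W)"
    then show "\<phi> (a \<odot>\<^bsub>quotient_module M W\<^esub> A) = a \<odot>\<^bsub>quotient_module N B\<^esub> \<phi> A"
      using f(1) by (auto simp: carM smult_quotient_module[OF M] smult_quotient_module[OF N] \<phi> f(3))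
  qed
qed

section \<open>Boundaries of simplicial chains\<close>

definition face_sum :: "'v::order set \<Rightarrow> ('v set \<Rightarrow>\<^sub>0 rat)" where
  "face_sum \<sigma> = (\<Sum>v\<in>\<sigma>. Poly_Mapping.single (\<sigma> - {v}) ((- 1) ^ card {w \<in> \<sigma>. w < v}))"

lemma boundary_eq: "(boundary :: ('v::order set \<Rightarrow>\<^sub>0 rat) \<Rightarrow> _) = lin_ext face_sum"
proof
  fix c :: "'v set \<Rightarrow>\<^sub>0 rat"
  show "boundary c = lin_ext face_sum c"
    unfolding boundary_def lin_ext_def face_sum_def scale_sum scale_single
    by (intro sum.cong refl arg_cong2[of _ _ _ _ Poly_Mapping.single] mult.commute)
qed

lemma boundary_single: "boundary (Poly_Mapping.single \<sigma> a) = scale a (face_sum \<sigma>)"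
  by (simp add: boundary_eq)

lemma lookup_face_sum:
  assumes "finite \<sigma>"
  shows "coeff (face_sum \<sigma>) \<tau> =
    (\<Sum>v\<in>\<sigma>. if \<sigma> - {v} = \<tau> then (- 1) ^ card {w \<in> \<sigma>. w < v} else 0)"
  by (simp add: face_sum_def lookup_sum lookup_single when_def)

lemma keys_face_sum: "supp (face_sum \<sigma>) \<subseteq> (\<lambda>v. \<sigma> - {v}) ` \<sigma>"
proof
  fix \<tau> assume "\<tau> \<in> supp (face_sum \<sigma>)"
  then have "coeff (face_sum \<sigma>) \<tau> \<noteq> 0" by (simp add: in_keys_iff)
  then have "\<exists>v\<in>\<sigma>. coeff (Poly_Mapping.single (\<sigma> - {v}) ((- 1 :: rat) ^ card {w \<in> \<sigma>. w < v})) \<tau> \<noteq> 0"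
    unfolding face_sum_def lookup_sum by (meson sum.neutral)
  then show "\<tau> \<in> (\<lambda>v. \<sigma> - {v}) ` \<sigma>"
    by (auto simp: lookup_single when_def split: if_splits)
qed

lemma keys_boundary: "supp (boundary c) \<subseteq> (\<Union>\<sigma>\<in>supp c. (\<lambda>v. \<sigma> - {v}) ` \<sigma>)"
proof -
  have "supp (boundary c) \<subseteq> (\<Union>\<sigma>\<in>supp c. supp (face_sum \<sigma>))"
    unfolding boundary_eq by (rule keys_lin_ext)
  also have "\<dots> \<subseteq> (\<Union>\<sigma>\<in>supp c. (\<lambda>v. \<sigma> - {v}) ` \<sigma>)"
    by (intro UN_mono order_refl keys_face_sum)
  finally show ?thesis .
qed

lemma lookup_face_sum_remove:
  assumes "finite \<sigma>" "v \<in> \<sigma>"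
  shows "coeff (face_sum \<sigma>) (\<sigma> - {v}) = (- 1) ^ card {w \<in> \<sigma>. w < v}"
proof -
  have "coeff (face_sum \<sigma>) (\<sigma> - {v}) =
      (\<Sum>u\<in>\<sigma>. if u = v then (- 1) ^ card {w \<in> \<sigma>. w < v} else 0)"
    unfolding lookup_face_sum[OF assms(1)] using assms(2) by (intro sum.cong) auto
  then show ?thesis using assms by simp
qed

text \<open>Up to sign, the coefficient of the only possible coface is the coefficient of \<tau> in
  the boundary. This turns the cycle condition into the vanishing of single coefficients, both for
  pushing off a vertex and for analysing a lowest simplex.\<close>

lemma unique_coface_zero:
  assumes c: "boundary c = 0" and v: "v \<notin> \<tau>" "finite \<tau>"
    and uniq: "\<And>w. w \<notin> \<tau> \<Longrightarrow> w \<noteq> v \<Longrightarrow> coeff c (insert w \<tau>) = 0"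
  shows "coeff c (insert v \<tau>) = 0"
proof (rule ccontr)
  assume nz: "coeff c (insert v \<tau>) \<noteq> 0"
  have "coeff (boundary c) \<tau> = (\<Sum>\<sigma>\<in>supp c. coeff c \<sigma> * coeff (face_sum \<sigma>) \<tau>)"
    by (simp add: boundary_eq lookup_lin_ext)
  also have "\<dots> = (\<Sum>\<sigma>\<in>{insert v \<tau>}. coeff c \<sigma> * coeff (face_sum \<sigma>) \<tau>)"
  proof (rule sum.mono_neutral_right)
    show "\<forall>\<sigma>\<in>supp c - {insert v \<tau>}. coeff c \<sigma> * coeff (face_sum \<sigma>) \<tau> = 0"
    proof
      fix \<sigma> assume \<sigma>: "\<sigma> \<in> supp c - {insert v \<tau>}"
      have "\<tau> \<notin> supp (face_sum \<sigma>)"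
      proof
        assume "\<tau> \<in> supp (face_sum \<sigma>)"
        then obtain w where "w \<in> \<sigma>" "\<tau> = \<sigma> - {w}" using keys_face_sum by blast
        then have "\<sigma> = insert w \<tau>" "w \<notin> \<tau>" by auto
        with \<sigma> uniq[of w] show False by (auto simp: in_keys_iff)
      qed
      then show "coeff c \<sigma> * coeff (face_sum \<sigma>) \<tau> = 0" by (simp add: in_keys_iff)
    qed
  qed (use nz in \<open>auto simp: in_keys_iff\<close>)
  also have "\<dots> = coeff c (insert v \<tau>) * (- 1) ^ card {w \<in> insert v \<tau>. w < v}"
    using lookup_face_sum_remove[of "insert v \<tau>" v] v by simp
  finally show False using nz c by simp
qed

text \<open>Two vertices removed in either order leave the same face with opposite signs, because
  removing the smaller one shifts the position of the larger. The double sum therefore equals its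
  own negative.\<close>

lemma boundary_face_sum:
  fixes \<sigma> :: "'v::order set"
  assumes fin: "finite \<sigma>" and total: "\<And>v w. v \<in> \<sigma> \<Longrightarrow> w \<in> \<sigma> \<Longrightarrow> v \<le> w \<or> w \<le> v"
  shows "boundary (face_sum \<sigma>) = 0"
proof -
  define e :: "'v \<Rightarrow> 'v set \<Rightarrow> rat" where "e v \<tau> = (- 1) ^ card {w \<in> \<tau>. w < v}" for v \<tau>
  define f where "f v w = Poly_Mapping.single (\<sigma> - {v} - {w}) (e v \<sigma> * e w (\<sigma> - {v}))" for v w
  have anti: "f w v = - f v w" if vw: "v \<in> \<sigma>" "w \<in> \<sigma>" "v < w" for v w
  proof -
    have 1: "e v (\<sigma> - {w}) = e v \<sigma>"
      using vw by (auto simp: e_def intro!: arg_cong[of _ _ "\<lambda>n. (- 1) ^ n"] arg_cong[of _ _ card])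
    have "{u \<in> \<sigma>. u < w} = insert v {u \<in> \<sigma> - {v}. u < w}" using vw by auto
    then have 2: "e w \<sigma> = - e w (\<sigma> - {v})" using fin by (simp add: e_def)
    have "\<sigma> - {w} - {v} = \<sigma> - {v} - {w}" by auto
    then show ?thesis by (simp add: f_def 1 2 single_uminus mult.commute)
  qed
  have anti: "f w v = - f v w" if "v \<in> \<sigma>" "w \<in> \<sigma> - {v}" for v w
    using anti[of v w] anti[of w v] that total[of v w] by force
  have eq: "boundary (face_sum \<sigma>) = (\<Sum>v\<in>\<sigma>. \<Sum>w\<in>\<sigma> - {v}. f v w)"
    by (simp add: face_sum_def boundary_eq lin_ext_sum scale_sum scale_single e_def f_def)
  also have "\<dots> = (\<Sum>v\<in>\<sigma>. \<Sum>w\<in>{w \<in> \<sigma>. w \<noteq> v}. f v w)"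
    by (intro sum.cong) auto
  also have "\<dots> = (\<Sum>w\<in>\<sigma>. \<Sum>v\<in>{v \<in> \<sigma>. w \<noteq> v}. f v w)"
    by (rule sum.swap_restrict) (use fin in auto)
  also have "\<dots> = (\<Sum>w\<in>\<sigma>. \<Sum>v\<in>\<sigma> - {w}. - f w v)"
    by (intro sum.cong) (auto simp: anti)
  also have "\<dots> = - boundary (face_sum \<sigma>)"
    by (simp add: eq sum_negf)
  finally have neg: "boundary (face_sum \<sigma>) = - boundary (face_sum \<sigma>)" .
  have "coeff (boundary (face_sum \<sigma>)) \<rho> = 0" for \<rho>
    using arg_cong[OF neg, of "\<lambda>c. coeff c \<rho>"] by simp
  then show ?thesis by (intro poly_mapping_eqI) simp
qed

lemma boundary_boundary:
  assumes "\<And>\<sigma>. \<sigma> \<in> supp c \<Longrightarrow> finite \<sigma>"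
    and "\<And>\<sigma> v w. \<sigma> \<in> supp c \<Longrightarrow> v \<in> \<sigma> \<Longrightarrow> w \<in> \<sigma> \<Longrightarrow> v \<le> w \<or> w \<le> v"
  shows "boundary (boundary c) = 0"
proof -
  have "boundary (boundary c) = lin_ext (\<lambda>\<sigma>. boundary (face_sum \<sigma>)) c"
    by (simp add: boundary_eq lin_ext_lin_ext)
  also have "\<dots> = 0"
    using assms by (intro lin_ext_eq_0 boundary_face_sum) auto
  finally show ?thesis .
qed

text \<open>The new vertex carries no sign: boundaries of cones are only computed for an apex below
  all other vertices, hence in position 0.\<close>

definition cone :: "'v \<Rightarrow> ('v set \<Rightarrow>\<^sub>0 rat) \<Rightarrow> ('v set \<Rightarrow>\<^sub>0 rat)" where
  "cone v = lin_ext (\<lambda>\<sigma>. Poly_Mapping.single (insert v \<sigma>) 1)"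

lemma cone_simps [simp]:
  "cone v 0 = 0" "cone v (c + d) = cone v c + cone v d" "cone v (c - d) = cone v c - cone v d"
  "cone v (- c) = - cone v c"
  by (simp_all add: cone_def lin_ext_add lin_ext_diff lin_ext_minus)

lemma keys_cone: "supp (cone v c) \<subseteq> insert v ` supp c"
  using keys_lin_ext[of "\<lambda>\<sigma>. Poly_Mapping.single (insert v \<sigma>) 1" c] by (auto simp: cone_def)

lemma lookup_cone:
  assumes "\<And>\<sigma>. \<sigma> \<in> supp c \<Longrightarrow> v \<notin> \<sigma>"
  shows "coeff (cone v c) \<tau> = (if v \<in> \<tau> then coeff c (\<tau> - {v}) else 0)"
proof -
  have "coeff (cone v c) \<tau> = (\<Sum>\<sigma>\<in>supp c. if \<sigma> = \<tau> - {v} \<and> v \<in> \<tau> then coeff c \<sigma> else 0)"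
    unfolding cone_def lookup_lin_ext
    by (intro sum.cong) (use assms in \<open>auto simp: lookup_single when_def\<close>)
  also have "\<dots> = (if v \<in> \<tau> then coeff c (\<tau> - {v}) else 0)"
    by (auto simp: in_keys_iff)
  finally show ?thesis .
qed

text \<open>The face opposite to the apex has sign plus; every other vertex moves up by one
  position, whence the minus sign.\<close>

lemma face_sum_insert_least:
  fixes \<sigma> :: "'v::order set"
  assumes fin: "finite \<sigma>" and less: "\<And>w. w \<in> \<sigma> \<Longrightarrow> v < w"
  shows "face_sum (insert v \<sigma>) = Poly_Mapping.single \<sigma> 1 - cone v (face_sum \<sigma>)"
proof -
  have v: "v \<notin> \<sigma>" using less by auto
  have 1: "{w. (w = v \<or> w \<in> \<sigma>) \<and> w < v} = {}" using less by (auto dest: less_asym)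
  have 2: "card {w \<in> insert v \<sigma>. w < u} = Suc (card {w \<in> \<sigma>. w < u})" if "u \<in> \<sigma>" for u
  proof -
    have "{w \<in> insert v \<sigma>. w < u} = insert v {w \<in> \<sigma>. w < u}" using less that by auto
    then show ?thesis using fin v by simp
  qed
  have "(\<Sum>u\<in>\<sigma>. Poly_Mapping.single (insert v \<sigma> - {u}) ((- 1 :: rat) ^ card {w \<in> insert v \<sigma>. w < u})) =
      (\<Sum>u\<in>\<sigma>. - cone v (Poly_Mapping.single (\<sigma> - {u}) ((- 1) ^ card {w \<in> \<sigma>. w < u})))"
  proof (intro sum.cong refl)
    fix u assume u: "u \<in> \<sigma>"
    then have "insert v \<sigma> - {u} = insert v (\<sigma> - {u})" using v by auto
    then show "Poly_Mapping.single (insert v \<sigma> - {u}) ((- 1 :: rat) ^ card {w \<in> insert v \<sigma>. w < u}) =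
        - cone v (Poly_Mapping.single (\<sigma> - {u}) ((- 1) ^ card {w \<in> \<sigma>. w < u}))"
      by (simp add: 2[OF u, simplified] cone_def scale_single single_uminus)
  qed
  then show ?thesis
    using fin v by (simp add: face_sum_def 1 cone_def lin_ext_sum sum_negf)
qed

lemma boundary_cone:
  assumes "\<And>\<sigma>. \<sigma> \<in> supp c \<Longrightarrow> finite \<sigma>" and "\<And>\<sigma> w. \<sigma> \<in> supp c \<Longrightarrow> w \<in> \<sigma> \<Longrightarrow> v < w"
  shows "boundary (cone v c) = c - cone v (boundary c)"
proof -
  have "boundary (cone v c) = lin_ext (\<lambda>\<sigma>. face_sum (insert v \<sigma>)) c"
    by (simp add: boundary_eq cone_def lin_ext_lin_ext)
  also have "\<dots> = lin_ext (\<lambda>\<sigma>. Poly_Mapping.single \<sigma> 1 - cone v (face_sum \<sigma>)) c"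
    using assms by (intro lin_ext_cong face_sum_insert_least) auto
  also have "\<dots> = lin_ext (\<lambda>\<sigma>. Poly_Mapping.single \<sigma> 1) c - lin_ext (\<lambda>\<sigma>. cone v (face_sum \<sigma>)) c"
    by (auto simp: lin_ext_def scale_diff sum_subtractf)
  also have "\<dots> = c - cone v (boundary c)"
    by (simp add: lin_ext_single_id boundary_eq cone_def lin_ext_lin_ext)
  finally show ?thesis .
qed

section \<open>Contracting the complex onto the subsets of \<open>I\<close>\<close>

lemma chain_subset_insert:
  "chain_subset (insert A \<sigma>) \<longleftrightarrow> chain_subset \<sigma> \<and> (\<forall>B\<in>\<sigma>. A \<subseteq> B \<or> B \<subseteq> A)"
  unfolding chain_subset_def by blast

lemma chain_subset_mono: "chain_subset \<sigma> \<Longrightarrow> \<tau> \<subseteq> \<sigma> \<Longrightarrow> chain_subset \<tau>"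
  by (auto simp: chain_subset_def)

lemma chain_subset_card_less:
  assumes "chain_subset \<sigma>" "A \<in> \<sigma>" "B \<in> \<sigma>" "finite A" "card A < card B"
  shows "A \<subset> B"
  using assms card_mono[of A B] by (auto simp: chain_subset_def)

lemma inj_on_card_chain:
  assumes "chain_subset \<sigma>" "\<And>A. A \<in> \<sigma> \<Longrightarrow> finite A"
  shows "inj_on card \<sigma>"
  using assms by (intro inj_onI) (metis card_subset_eq chain_subset_def)

text \<open>These are the odd sizes strictly between \<open>2 * l\<close> and
  \<open>2 * l + 2 * k\<close>. That there are just \<open>k\<close> of them bounds the length of
  chains of odd sets and forces a chain of length \<open>k\<close> to use every size.\<close>

lemma card_odd_between:
  "card {m. 2 * l < m \<and> m < 2 * l + 2 * k \<and> odd m} = (k :: nat)"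
proof -
  have "{m. 2 * l < m \<and> m < 2 * l + 2 * k \<and> odd m} = (\<lambda>i. 2 * (l + i) + 1) ` {..<k}"
  proof (intro equalityI subsetI)
    fix m assume "m \<in> {m. 2 * l < m \<and> m < 2 * l + 2 * k \<and> odd m}"
    then show "m \<in> (\<lambda>i. 2 * (l + i) + 1) ` {..<k}"
      by (intro image_eqI[of _ _ "m div 2 - l"]) (auto elim!: oddE)
  qed auto
  moreover have "inj_on (\<lambda>i. 2 * (l + i) + 1) {..<k}" by (auto simp: inj_on_def)
  ultimately show ?thesis by (simp add: card_image)
qed

text \<open>
  The link of \<open>J\<close> in \<open>c\<close> lies in a cone with apex \<open>J0\<close>, so \<open>J\<close> can be pushed off \<open>c\<close> through the cone.
\<close>

lemma remove_vertex:
  fixes J J0 :: "'v::order"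
  assumes c: "boundary c = 0"
    and fin: "\<And>\<sigma>. \<sigma> \<in> supp c \<Longrightarrow> finite \<sigma>"
    and total: "\<And>\<sigma> v w. \<sigma> \<in> supp c \<Longrightarrow> v \<in> \<sigma> \<Longrightarrow> w \<in> \<sigma> \<Longrightarrow> v \<le> w \<or> w \<le> v"
    and J: "J0 < J" "\<And>\<sigma> w. \<sigma> \<in> supp c \<Longrightarrow> J \<in> \<sigma> \<Longrightarrow> w \<in> \<sigma> \<Longrightarrow> w < J \<Longrightarrow> w \<le> J0"
  obtains d where "supp d \<subseteq> {insert J0 \<rho> | \<rho>. \<rho> \<in> supp c \<and> J \<in> \<rho> \<and> J0 \<notin> \<rho>}"
    and "\<And>\<sigma>. \<sigma> \<in> supp (c - boundary d) \<Longrightarrow> J \<notin> \<sigma>" "boundary (boundary d) = 0"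
proof -
  \<comment> \<open>The sign of the face opposite to \<open>J0\<close> in
    \<open>insert J0 \<rho>\<close>; multiplied by it, this face appears in the boundary with
    coefficient one.\<close>
  define s :: "'v set \<Rightarrow> rat" where "s \<rho> = (- 1) ^ card {w \<in> \<rho>. w < J0}" for \<rho>
  define f where "f \<rho> = (if J \<in> \<rho> \<and> J0 \<notin> \<rho> then Poly_Mapping.single (insert J0 \<rho>) (s \<rho>) else 0)" for \<rho>
  define d where "d = lin_ext f c"
  have supp_f: "supp (f \<rho>) \<subseteq> (if J \<in> \<rho> \<and> J0 \<notin> \<rho> then {insert J0 \<rho>} else {})" for \<rho>
    by (auto simp: f_def)
  have supp_d: "supp d \<subseteq> {insert J0 \<rho> | \<rho>. \<rho> \<in> supp c \<and> J \<in> \<rho> \<and> J0 \<notin> \<rho>}"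
  proof
    fix \<sigma> assume "\<sigma> \<in> supp d"
    then obtain \<rho> where "\<rho> \<in> supp c" "\<sigma> \<in> supp (f \<rho>)"
      using keys_lin_ext[of f c] unfolding d_def by blast
    then show "\<sigma> \<in> {insert J0 \<rho> | \<rho>. \<rho> \<in> supp c \<and> J \<in> \<rho> \<and> J0 \<notin> \<rho>}"
      using supp_f[of \<rho>] by (auto split: if_splits)
  qed
  have bbd: "boundary (boundary d) = 0"
  proof (rule boundary_boundary)
    fix \<sigma> assume "\<sigma> \<in> supp d"
    then obtain \<rho> where \<rho>: "\<sigma> = insert J0 \<rho>" "\<rho> \<in> supp c" "J \<in> \<rho>" "J0 \<notin> \<rho>"
      using supp_d by blast
    show "finite \<sigma>" using \<rho> fin by simp
    fix v w assume vw: "v \<in> \<sigma>" "w \<in> \<sigma>"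
    have "u \<le> J0 \<or> J0 \<le> u" if "u \<in> \<rho>" for u
      using total[OF \<rho>(2) that \<rho>(3)] J(2)[OF \<rho>(2,3) that] J(1) by force
    then show "v \<le> w \<or> w \<le> v"
      using vw total[OF \<rho>(2), of v w] \<rho>(1) by auto
  qed
  define e where "e = c - boundary d"
  have be: "boundary e = 0"
    using c bbd by (simp add: e_def boundary_eq lin_ext_diff)
  \<comment> \<open>All facets of \<open>insert J0 \<rho>\<close> other than \<rho> still contain
    \<open>J0\<close>. On simplices with \<open>J\<close> but without \<open>J0\<close> the boundary
    of \<open>d\<close> therefore agrees with \<open>c\<close>.\<close>
  have e0: "coeff e \<sigma> = 0" if \<sigma>: "J \<in> \<sigma>" "J0 \<notin> \<sigma>" for \<sigma>
  proof -
    have "coeff (boundary d) \<sigma> = (\<Sum>\<rho>\<in>supp c. coeff c \<rho> * coeff (boundary (f \<rho>)) \<sigma>)"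
      by (simp add: d_def boundary_eq lin_ext_lin_ext lookup_lin_ext)
    also have "\<dots> = (\<Sum>\<rho>\<in>supp c. if \<rho> = \<sigma> then coeff c \<rho> else 0)"
    proof (intro sum.cong refl)
      fix \<rho> assume \<rho>: "\<rho> \<in> supp c"
      show "coeff c \<rho> * coeff (boundary (f \<rho>)) \<sigma> = (if \<rho> = \<sigma> then coeff c \<rho> else 0)"
      proof (cases "\<rho> = \<sigma>")
        case True
        have "{w \<in> insert J0 \<sigma>. w < J0} = {w \<in> \<sigma>. w < J0}" by auto
        then have "coeff (face_sum (insert J0 \<sigma>)) \<sigma> = s \<sigma>"
          using lookup_face_sum_remove[of "insert J0 \<sigma>" J0] fin[OF \<rho>] True \<sigma>(2)
          by (simp add: s_def)
        then have "coeff (boundary (f \<rho>)) \<sigma> = s \<sigma> * s \<sigma>"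
          using True \<sigma> by (simp add: f_def boundary_single lookup_map_mult)
        then show ?thesis using True by (simp add: s_def flip: power_add)
      next
        case False
        have "\<sigma> \<notin> supp (boundary (f \<rho>))"
        proof
          assume "\<sigma> \<in> supp (boundary (f \<rho>))"
          then obtain \<tau> v where "\<tau> \<in> supp (f \<rho>)" "v \<in> \<tau>" "\<sigma> = \<tau> - {v}"
            using keys_boundary[of "f \<rho>"] by blast
          then show False using supp_f[of \<rho>] \<sigma> False by (auto split: if_splits)
        qed
        then show ?thesis using False by (simp add: in_keys_iff)
      qed
    qed
    also have "\<dots> = coeff c \<sigma>" by (auto simp: in_keys_iff)
    finally show ?thesis by (simp add: e_def lookup_minus)
  qed
  have "J \<notin> \<sigma>" if \<sigma>: "\<sigma> \<in> supp e" for \<sigma>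
  proof
    assume J\<sigma>: "J \<in> \<sigma>"
    then have J0\<sigma>: "J0 \<in> \<sigma>" using \<sigma> e0 by (auto simp: in_keys_iff)
    have fin\<sigma>: "finite \<sigma>"
    proof -
      have "supp e \<subseteq> supp c \<union> supp (boundary d)" unfolding e_def by (rule keys_diff)
      with \<sigma> consider "\<sigma> \<in> supp c" | "\<sigma> \<in> supp (boundary d)" by blast
      then show ?thesis
      proof cases
        case 2
        then obtain \<tau> v where "\<tau> \<in> supp d" "\<sigma> = \<tau> - {v}"
          using subsetD[OF keys_boundary] by blast
        moreover obtain \<rho> where "\<rho> \<in> supp c" "\<tau> = insert J0 \<rho>" using \<open>\<tau> \<in> supp d\<close> supp_d by blast
        ultimately show ?thesis using fin[of \<rho>] by simp
      qed (rule fin)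
    qed
    \<comment> \<open>The face without \<open>J0\<close> still contains \<open>J\<close>, so by
      \<open>e0\<close> its only possible coface in \<open>e\<close> is the one obtained by adding
      \<open>J0\<close>.\<close>
    have "coeff e (insert J0 (\<sigma> - {J0})) = 0"
    proof (rule unique_coface_zero[OF be])
      fix w assume "w \<notin> \<sigma> - {J0}" "w \<noteq> J0"
      then show "coeff e (insert w (\<sigma> - {J0})) = 0" using J(1) J\<sigma> by (intro e0) auto
    qed (use fin\<sigma> in auto)
    then show False using \<sigma> J0\<sigma> by (simp add: insert_absorb in_keys_iff)
  qed
  with supp_d bbd show thesis by (intro that[of d]) (auto simp: e_def)
qed

text \<open>Vertices not contained in \<open>I\<close> are replaced by their traces on
  \<open>I\<close>, a smallest one at a time. Each replacement introduces no vertex but a subset of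
  \<open>I\<close>, so the number of vertices outside drops.\<close>

lemma homologous_in_Pow:
  fixes V :: "nat set set"
  defines "K \<equiv> {\<sigma>. \<sigma> \<subseteq> V \<and> chain_subset \<sigma>}"
  assumes V: "finite V" "\<And>J. J \<in> V \<Longrightarrow> finite J" "\<And>J. J \<in> V \<Longrightarrow> J \<inter> I \<in> V"
    and c: "boundary c = 0" "supp c \<subseteq> {\<sigma> \<in> K. card \<sigma> = p}"
  shows "\<exists>d. supp d \<subseteq> {\<sigma> \<in> K. card \<sigma> = Suc p} \<and> boundary (c - boundary d) = 0 \<and>
    supp (c - boundary d) \<subseteq> {\<sigma> \<in> K. card \<sigma> = p \<and> \<sigma> \<subseteq> Pow I}"
  using c
proof (induction "card {J \<in> \<Union>(supp c). \<not> J \<subseteq> I}" arbitrary: c rule: less_induct)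
  case less
  let ?bad = "\<lambda>c. {J \<in> \<Union>(supp c). \<not> J \<subseteq> I}"
  have Kfin: "finite \<sigma>" if "\<sigma> \<in> K" for \<sigma>
    using that V(1) finite_subset by (auto simp: K_def)
  have finbad: "finite (?bad c)"
    using less.prems(2) V(1) by (auto intro!: finite_subset[OF _ V(1)] simp: K_def)
  show ?case
  proof (cases "?bad c = {}")
    case True
    then show ?thesis using less.prems by (intro exI[of _ 0]) (auto simp: boundary_eq)
  next
    case False
    \<comment> \<open>Minimal size puts every vertex strictly below \<open>J\<close> inside
      \<open>I\<close>, hence inside \<open>J \<inter> I\<close>. This is the cone that
      \<open>remove_vertex\<close> asks for.\<close>
    define J where "J = arg_min_on card (?bad c)"
    have J: "J \<in> ?bad c" "\<And>J'. J' \<in> ?bad c \<Longrightarrow> card J \<le> card J'"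
      using arg_min_if_finite(1)[OF finbad False] arg_min_least[OF finbad False]
      by (simp_all only: J_def)
    obtain \<sigma>0 where \<sigma>0: "\<sigma>0 \<in> supp c" "J \<in> \<sigma>0" using J(1) by blast
    then have JV: "J \<in> V" using less.prems(2) by (auto simp: K_def)
    have below: "w \<subseteq> J \<inter> I" if "\<sigma> \<in> supp c" "w \<in> \<sigma>" "w \<subset> J" for \<sigma> w
    proof -
      have "card w < card J" using V(2)[OF JV] that(3) by (rule psubset_card_mono)
      then have "w \<subseteq> I" using J(2)[of w] that by force
      then show ?thesis using that by auto
    qed
    obtain d where d: "supp d \<subseteq> {insert (J \<inter> I) \<rho> | \<rho>. \<rho> \<in> supp c \<and> J \<in> \<rho> \<and> J \<inter> I \<notin> \<rho>}"
      and nJ: "\<And>\<sigma>. \<sigma> \<in> supp (c - boundary d) \<Longrightarrow> J \<notin> \<sigma>" and bb: "boundary (boundary d) = 0"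
    proof (rule remove_vertex[of c "J \<inter> I" J])
      show "J \<inter> I < J" using J(1) by auto
      fix \<sigma> assume "\<sigma> \<in> supp c"
      then have \<sigma>: "\<sigma> \<in> K" using less.prems(2) by blast
      then show "finite \<sigma>" by (rule Kfin)
      show "v \<le> w \<or> w \<le> v" if "v \<in> \<sigma>" "w \<in> \<sigma>" for v w
        using \<sigma> that by (auto simp: K_def chain_subset_def)
    qed (use less.prems(1) below in auto)
    have dK: "\<sigma> \<in> K \<and> card \<sigma> = Suc p \<and> (\<forall>w\<in>\<sigma>. w = J \<inter> I \<or> w \<in> \<Union>(supp c))" if \<sigma>d: "\<sigma> \<in> supp d" for \<sigma>
    proof -
      obtain \<rho> where \<rho>: "\<sigma> = insert (J \<inter> I) \<rho>" "\<rho> \<in> supp c" "J \<in> \<rho>" "J \<inter> I \<notin> \<rho>"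
        using subsetD[OF d \<sigma>d] by blast
      have \<rho>K: "\<rho> \<in> K" "card \<rho> = p" using \<rho>(2) less.prems(2) by auto
      have \<rho>V: "\<rho> \<subseteq> V" "chain_subset \<rho>" using \<rho>K(1) by (auto simp: K_def)
      have "J \<inter> I \<subseteq> w \<or> w \<subseteq> J \<inter> I" if w: "w \<in> \<rho>" for w
      proof (cases "w \<subset> J")
        case True
        then show ?thesis using below[OF \<rho>(2) w] by simp
      next
        case False
        then have "J \<subseteq> w" using \<rho>V(2) w \<rho>(3) by (auto simp: chain_subset_def)
        then show ?thesis by blast
      qed
      then have "chain_subset \<sigma>" using \<rho>V(2) \<rho>(1) by (simp add: chain_subset_insert)
      moreover have "\<sigma> \<subseteq> V" using \<rho>(1) \<rho>V(1) V(3)[OF JV] by simp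
      moreover have "card \<sigma> = Suc p" using \<rho>(1,4) \<rho>K Kfin[OF \<rho>K(1)] by simp
      moreover have "\<forall>w\<in>\<sigma>. w = J \<inter> I \<or> w \<in> \<Union>(supp c)" using \<rho>(1,2) by blast
      ultimately show ?thesis by (simp add: K_def)
    qed
    define e where "e = c - boundary d"
    have be: "boundary e = 0" using less.prems(1) bb by (simp add: e_def boundary_eq lin_ext_diff)
    have eK: "\<sigma> \<in> K \<and> card \<sigma> = p \<and> (\<forall>w\<in>\<sigma>. w = J \<inter> I \<or> w \<in> \<Union>(supp c))" if \<sigma>: "\<sigma> \<in> supp e" for \<sigma>
    proof -
      have "supp e \<subseteq> supp c \<union> supp (boundary d)" unfolding e_def by (rule keys_diff)
      with \<sigma> consider "\<sigma> \<in> supp c" | "\<sigma> \<in> supp (boundary d)" by blast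
      then show ?thesis
      proof cases
        case 1
        then show ?thesis using less.prems(2) by auto
      next
        case 2
        then obtain \<tau> v where \<tau>: "\<tau> \<in> supp d" "v \<in> \<tau>" "\<sigma> = \<tau> - {v}"
          using subsetD[OF keys_boundary] by blast
        have \<tau>K: "\<tau> \<in> K" "card \<tau> = Suc p" "\<forall>w\<in>\<tau>. w = J \<inter> I \<or> w \<in> \<Union>(supp c)"
          using dK[OF \<tau>(1)] by simp_all
        have "chain_subset \<sigma>" "\<sigma> \<subseteq> V"
          using \<tau>K(1) \<tau>(3) chain_subset_mono[of \<tau> \<sigma>] by (auto simp: K_def)
        moreover have "card \<sigma> = p" using \<tau>K(2) \<tau>(2,3) Kfin[OF \<tau>K(1)] by simp
        moreover have "\<forall>w\<in>\<sigma>. w = J \<inter> I \<or> w \<in> \<Union>(supp c)" using \<tau>K(3) \<tau>(3) by blast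
        ultimately show ?thesis by (simp add: K_def)
      qed
    qed
    have "?bad e \<subseteq> ?bad c - {J}"
      using eK nJ unfolding e_def by blast
    then have "?bad e \<subset> ?bad c" using J(1) by blast
    then have "card (?bad e) < card (?bad c)" using finbad by (intro psubset_card_mono)
    moreover have "supp e \<subseteq> {\<sigma> \<in> K. card \<sigma> = p}" using eK by blast
    ultimately obtain d' where d': "supp d' \<subseteq> {\<sigma> \<in> K. card \<sigma> = Suc p}" "boundary (e - boundary d') = 0"
      "supp (e - boundary d') \<subseteq> {\<sigma> \<in> K. card \<sigma> = p \<and> \<sigma> \<subseteq> Pow I}"
      using less.hyps[of e] be by blast
    have *: "c - boundary (d + d') = e - boundary d'"
      by (simp add: e_def boundary_eq lin_ext_add algebra_simps)
    show ?thesis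
    proof (intro exI[of _ "d + d'"] conjI)
      show "supp (d + d') \<subseteq> {\<sigma> \<in> K. card \<sigma> = Suc p}"
        using Poly_Mapping.keys_add[of d d'] dK d'(1) by blast
    qed (use d' * in auto)
  qed
qed

text \<open>The map induced on chains by intersection with \<open>I\<close>; a simplex whose
  vertices lose their distinctness becomes degenerate and is sent to zero. No sign occurs because
  intersection preserves inclusions.\<close>

definition retract :: "nat set \<Rightarrow> nat set set \<Rightarrow> (nat set set \<Rightarrow>\<^sub>0 rat)" where
  "retract I \<sigma> = (if inj_on (\<lambda>J. J \<inter> I) \<sigma> then Poly_Mapping.single ((\<lambda>J. J \<inter> I) ` \<sigma>) 1 else 0)"

text \<open>
  At most two facets of \<open>\<sigma>\<close> survive the retraction, those opposite to two adjacent vertices with the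
  same trace on \<open>I\<close>; they have the same image and opposite signs.
\<close>

lemma retract_face_sum:
  assumes fin: "finite \<sigma>" and chain: "chain_subset \<sigma>" and ninj: "\<not> inj_on (\<lambda>J. J \<inter> I) \<sigma>"
  shows "lin_ext (retract I) (face_sum \<sigma>) = 0"
proof -
  define t where "t J = J \<inter> I" for J
  define s :: "nat set \<Rightarrow> rat" where "s v = (- 1) ^ card {w \<in> \<sigma>. w < v}" for v
  have "\<exists>A B. A \<in> \<sigma> \<and> B \<in> \<sigma> \<and> A \<subset> B \<and> t A = t B"
    using ninj chain unfolding inj_on_def chain_subset_def t_def by (metis psubsetI)
  then obtain A B where AB: "A \<in> \<sigma>" "B \<in> \<sigma>" "A \<subset> B" "t A = t B" by blast
  have eq: "lin_ext (retract I) (face_sum \<sigma>) = (\<Sum>v\<in>\<sigma>. scale (s v) (retract I (\<sigma> - {v})))"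
    by (simp add: face_sum_def lin_ext_sum s_def)
  also have "\<dots> = (\<Sum>v\<in>{A, B}. scale (s v) (retract I (\<sigma> - {v})))"
  proof (rule sum.mono_neutral_right)
    show "\<forall>v\<in>\<sigma> - {A, B}. scale (s v) (retract I (\<sigma> - {v})) = 0"
    proof
      fix v assume "v \<in> \<sigma> - {A, B}"
      then have "\<not> inj_on t (\<sigma> - {v})" using AB unfolding inj_on_def by blast
      then show "scale (s v) (retract I (\<sigma> - {v})) = 0" by (simp add: retract_def t_def[abs_def])
    qed
  qed (use fin AB in auto)
  also have "\<dots> = scale (s A) (retract I (\<sigma> - {A})) + scale (s B) (retract I (\<sigma> - {B}))"
    using AB by auto
  also have "\<dots> = 0"
  proof -
    have im: "t ` (\<sigma> - {u}) = t ` \<sigma>" if "v \<in> \<sigma>" "v \<noteq> u" "t v = t u" "u \<in> \<sigma>" for u v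
    proof -
      have "t u \<in> t ` (\<sigma> - {u})" using that by (metis Diff_iff image_eqI singletonD)
      then have "insert (t u) (t ` (\<sigma> - {u})) = t ` (\<sigma> - {u})" by (rule insert_absorb)
      then show ?thesis using that(4) by (metis image_insert insert_Diff)
    qed
    have "A \<noteq> B" using AB(3) by blast
    then have im: "t ` (\<sigma> - {A}) = t ` \<sigma>" "t ` (\<sigma> - {B}) = t ` \<sigma>"
      using im[of B A] im[of A B] AB by auto
    have card_eq: "card (\<sigma> - {A}) = card (\<sigma> - {B})" using AB fin by simp
    show ?thesis
    proof (cases "inj_on t (\<sigma> - {A})")
      case True
      with card_eq have inj: "inj_on t (\<sigma> - {B})"
        using True im fin by (metis card_image eq_card_imp_inj_on finite_Diff)
      have "{w \<in> \<sigma>. w < B} = insert A {w \<in> \<sigma>. w < A}"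
      proof -
        \<comment> \<open>A member strictly between \<open>A\<close> and \<open>B\<close> would
          share their trace and contradict injectivity on the facet without \<open>A\<close>. So
          \<open>B\<close> stands exactly one position after \<open>A\<close>.\<close>
        have "w < A" if w: "w \<in> \<sigma>" "w < B" "w \<noteq> A" for w
        proof (rule ccontr)
          assume "\<not> w < A"
          then have "A \<subseteq> w" using w AB(1) chain unfolding chain_subset_def by blast
          then have "t w = t B" using w AB(4) unfolding t_def by auto
          then show False using True w AB(2,3) unfolding inj_on_def by auto
        qed
        then show ?thesis using AB by auto
      qed
      then have "s B = - s A" using fin by (simp add: s_def)
      then show ?thesis using True inj im
        by (auto simp: retract_def t_def[abs_def] scale_single single_uminus)
    next
      case False
      with card_eq have "\<not> inj_on t (\<sigma> - {B})"
        using False im fin by (metis card_image eq_card_imp_inj_on finite_Diff)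
      then show ?thesis using False by (simp add: retract_def t_def[abs_def])
    qed
  qed
  finally show ?thesis .
qed

text \<open>The retraction fixes this boundary, whose vertices are subsets of \<open>I\<close>, but
  it kills the boundary of each simplex of \<open>d\<close>: the \<open>k + 1\<close> vertices of
  such a simplex cannot keep distinct traces, as only \<open>k\<close> odd sizes are available below
  \<open>2 * k\<close>.\<close>

lemma boundary_in_Pow_zero:
  fixes I :: "nat set"
  assumes I: "finite I" "card I = 2 * k"
    and d: "\<And>\<sigma>. \<sigma> \<in> supp d \<Longrightarrow> chain_subset \<sigma> \<and> card \<sigma> = Suc k \<and> (\<forall>J\<in>\<sigma>. odd (card (J \<inter> I)))"
    and Pow: "\<And>\<sigma>. \<sigma> \<in> supp (boundary d) \<Longrightarrow> \<sigma> \<subseteq> Pow I"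
  shows "boundary d = 0"
proof -
  have "lin_ext (retract I) (face_sum \<sigma>) = 0" if \<sigma>: "\<sigma> \<in> supp d" for \<sigma>
  proof (rule retract_face_sum)
    show "finite \<sigma>" using d[OF \<sigma>] card.infinite by fastforce
    show "chain_subset \<sigma>" using d[OF \<sigma>] by blast
    show "\<not> inj_on (\<lambda>J. J \<inter> I) \<sigma>"
    proof
      assume inj: "inj_on (\<lambda>J. J \<inter> I) \<sigma>"
      let ?\<tau> = "(\<lambda>J. J \<inter> I) ` \<sigma>"
      have "chain_subset ?\<tau>" using d[OF \<sigma>] unfolding chain_subset_def by blast
      then have inj_card: "inj_on card ?\<tau>" using I(1) by (intro inj_on_card_chain) auto
      have "card ` ?\<tau> \<subseteq> {m. 2 * 0 < m \<and> m < 2 * 0 + 2 * k \<and> odd m}"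
      proof -
        have "0 < card (J \<inter> I) \<and> card (J \<inter> I) < 2 * k \<and> odd (card (J \<inter> I))" if "J \<in> \<sigma>" for J
        proof -
          have o: "odd (card (J \<inter> I))" using d[OF \<sigma>] that by blast
          have "card (J \<inter> I) \<le> 2 * k" using I card_mono[of I "J \<inter> I"] by auto
          moreover have "card (J \<inter> I) \<noteq> 2 * k"
          proof
            assume eq: "card (J \<inter> I) = 2 * k"
            show False using o unfolding eq by simp
          qed
          ultimately show ?thesis using odd_pos[OF o] o by (simp add: le_neq_trans)
        qed
        then show ?thesis by auto
      qed
      then have "card (card ` ?\<tau>) \<le> k"
        using card_mono[of "{m. 2 * 0 < m \<and> m < 2 * 0 + 2 * k \<and> odd m}" "card ` ?\<tau>"]
        by (simp add: card_odd_between[of 0, simplified])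
      then have "card ?\<tau> \<le> k" by (simp only: card_image[OF inj_card])
      then show False using inj d[OF \<sigma>] by (simp add: card_image)
    qed
  qed
  then have 0: "lin_ext (retract I) (boundary d) = 0"
    unfolding boundary_eq lin_ext_lin_ext by (rule lin_ext_eq_0)
  have "lin_ext (retract I) (boundary d) = lin_ext (\<lambda>\<sigma>. Poly_Mapping.single \<sigma> 1) (boundary d)"
  proof (rule lin_ext_cong)
    fix \<sigma> assume "\<sigma> \<in> supp (boundary d)"
    then have *: "J \<inter> I = J" if "J \<in> \<sigma>" for J using Pow that by blast
    then have "inj_on (\<lambda>J. J \<inter> I) \<sigma>" "(\<lambda>J. J \<inter> I) ` \<sigma> = \<sigma>" by (auto simp: inj_on_def)
    then show "retract I \<sigma> = Poly_Mapping.single \<sigma> 1" by (simp add: retract_def)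
  qed
  then show ?thesis using 0 by (simp add: lin_ext_single_id)
qed

section \<open>The cycle of a permutation\<close>

text \<open>The facet of the join that takes the left entry in every block. The right entry of a
  block becomes visible only through the next block, so the last entry of the list leaves no
  trace.\<close>

fun flag :: "nat set \<Rightarrow> nat list \<Rightarrow> nat set set" where
  "flag U (a # b # xs) = insert (insert a U) (flag (insert a (insert b U)) xs)"
| "flag U [a] = {}"
| "flag U [] = {}"

text \<open>
  The join of the zero-spheres that belong to the blocks. In both functions \<open>U\<close> is the union of the
  preceding blocks; lists of odd length are junk.
\<close>

fun block_cycle :: "nat set \<Rightarrow> nat list \<Rightarrow> (nat set set \<Rightarrow>\<^sub>0 rat)" where
  "block_cycle U (a # b # xs) =
     cone (insert a U) (block_cycle (insert a (insert b U)) xs)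
     - cone (insert b U) (block_cycle (insert a (insert b U)) xs)"
| "block_cycle U [a] = Poly_Mapping.single {} 1"
| "block_cycle U [] = Poly_Mapping.single {} 1"

text \<open>With \<open>U\<close> empty and \<open>card I = 2 * k\<close> these are the top
  simplices of P, the set \<open>I\<close> itself being excluded by parity. A general
  \<open>U\<close> of even size makes induction over the blocks possible.\<close>

definition odd_chains :: "nat set \<Rightarrow> nat set \<Rightarrow> nat \<Rightarrow> nat set set set" where
  "odd_chains U I k = {\<sigma>. finite \<sigma> \<and> chain_subset \<sigma> \<and> card \<sigma> = k \<and>
     (\<forall>F\<in>\<sigma>. U \<subset> F \<and> F \<subseteq> I \<and> odd (card F))}"

lemma odd_chains_insert:
  assumes \<tau>: "\<tau> \<in> odd_chains (insert a (insert b U)) I k"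
    and U: "finite U" "even (card U)" and ab: "c \<in> {a, b}" "a \<notin> U" "b \<notin> U" "a \<noteq> b" "insert c U \<subseteq> I"
  shows "insert (insert c U) \<tau> \<in> odd_chains U I (Suc k)" "insert c U \<notin> \<tau>"
proof -
  show n: "insert c U \<notin> \<tau>"
    using \<tau> ab unfolding odd_chains_def by blast
  have "\<forall>F\<in>\<tau>. insert c U \<subseteq> F \<or> F \<subseteq> insert c U"
    using \<tau> ab(1) unfolding odd_chains_def by blast
  moreover have "\<forall>F\<in>\<tau>. U \<subset> F"
    using \<tau> unfolding odd_chains_def by blast
  moreover have "U \<subset> insert c U" "odd (card (insert c U))" using ab U by auto
  ultimately show "insert (insert c U) \<tau> \<in> odd_chains U I (Suc k)"
    using \<tau> n ab(5) unfolding odd_chains_def by (simp add: chain_subset_insert)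
qed

lemma empty_odd_chains: "{} \<in> odd_chains U I 0"
  by (simp add: odd_chains_def chain_subset_def)

lemma flag_odd_chains:
  assumes "distinct xs" "set xs \<inter> U = {}" "even (length xs)" "finite U" "even (card U)" "U \<union> set xs \<subseteq> I"
  shows "flag U xs \<in> odd_chains U I (length xs div 2)"
  using assms
proof (induction U xs rule: flag.induct)
  case (1 U a b xs)
  have "flag (insert a (insert b U)) xs \<in> odd_chains (insert a (insert b U)) I (length xs div 2)"
    using 1 by (intro "1.IH") auto
  from odd_chains_insert(1)[OF this, of a] show ?case
    using "1.prems" by simp
qed (simp_all add: empty_odd_chains)

lemma supp_block_cycle_Cons:
  assumes "\<sigma> \<in> supp (block_cycle U (a # b # xs))"
  obtains c \<tau> where "c \<in> {a, b}" "\<tau> \<in> supp (block_cycle (insert a (insert b U)) xs)"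
    "\<sigma> = insert (insert c U) \<tau>"
proof -
  let ?C = "block_cycle (insert a (insert b U)) xs"
  have "supp (block_cycle U (a # b # xs)) \<subseteq> supp (cone (insert a U) ?C) \<union> supp (cone (insert b U) ?C)"
    unfolding block_cycle.simps by (rule keys_diff)
  also have "\<dots> \<subseteq> insert (insert a U) ` supp ?C \<union> insert (insert b U) ` supp ?C"
    by (intro Un_mono keys_cone)
  finally have "\<sigma> \<in> insert (insert a U) ` supp ?C \<union> insert (insert b U) ` supp ?C"
    using assms by (rule subsetD)
  then show thesis
  proof
    assume "\<sigma> \<in> insert (insert a U) ` supp ?C"
    then obtain \<tau> where "\<tau> \<in> supp ?C" "\<sigma> = insert (insert a U) \<tau>" by (rule imageE)
    then show thesis by (intro that[of a]) simp_all
  next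
    assume "\<sigma> \<in> insert (insert b U) ` supp ?C"
    then obtain \<tau> where "\<tau> \<in> supp ?C" "\<sigma> = insert (insert b U) \<tau>" by (rule imageE)
    then show thesis by (intro that[of b]) simp_all
  qed
qed

lemma block_cycle_odd_chains:
  assumes "distinct xs" "set xs \<inter> U = {}" "even (length xs)" "finite U" "even (card U)" "U \<union> set xs \<subseteq> I"
  shows "supp (block_cycle U xs) \<subseteq> odd_chains U I (length xs div 2)"
  using assms
proof (induction U xs rule: flag.induct)
  case (1 U a b xs)
  let ?C = "block_cycle (insert a (insert b U)) xs"
  have IH: "supp ?C \<subseteq> odd_chains (insert a (insert b U)) I (length xs div 2)"
    using 1 by (intro "1.IH") auto
  show ?case
  proof
    fix \<sigma> assume "\<sigma> \<in> supp (block_cycle U (a # b # xs))"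
    then obtain c \<tau> where c: "c \<in> {a, b}" and \<tau>: "\<tau> \<in> supp ?C" "\<sigma> = insert (insert c U) \<tau>"
      by (rule supp_block_cycle_Cons)
    then show "\<sigma> \<in> odd_chains U I (length (a # b # xs) div 2)"
      using odd_chains_insert(1)[OF subsetD[OF IH \<tau>(1)], of c] "1.prems" by auto
  qed
qed (simp_all add: empty_odd_chains)

text \<open>Both cones over the cycle \<open>?C\<close> have boundary \<open>?C\<close>, so their
  difference, a suspension, is a cycle. The induction starts from the empty simplex, whose boundary
  is zero also in the reduced complex.\<close>

lemma boundary_block_cycle:
  assumes "distinct xs" "set xs \<inter> U = {}" "even (length xs)" "finite U" "even (card U)"
  shows "boundary (block_cycle U xs) = 0"
  using assms
proof (induction U xs rule: flag.induct)
  case (1 U a b xs)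
  let ?U = "insert a (insert b U)"
  let ?C = "block_cycle ?U xs"
  have sub: "supp ?C \<subseteq> odd_chains ?U (?U \<union> set xs) (length xs div 2)"
    using "1.prems" by (intro block_cycle_odd_chains) auto
  have C: "boundary ?C = 0" using "1.prems" by (intro "1.IH") auto
  have *: "boundary (cone (insert c U) ?C) = ?C" if c: "c \<in> {a, b}" for c
  proof -
    have "boundary (cone (insert c U) ?C) = ?C - cone (insert c U) (boundary ?C)"
    proof (rule boundary_cone)
      fix \<sigma> assume "\<sigma> \<in> supp ?C"
      then have \<sigma>: "\<sigma> \<in> odd_chains ?U (?U \<union> set xs) (length xs div 2)" by (rule subsetD[OF sub])
      then show "finite \<sigma>" by (simp add: odd_chains_def)
      fix w assume "w \<in> \<sigma>"
      then have "?U \<subset> w" using \<sigma> by (simp add: odd_chains_def)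
      then show "insert c U < w" using c by auto
    qed
    then show ?thesis by (simp add: C)
  qed
  show ?case
    using *[of a] *[of b] unfolding block_cycle.simps boundary_eq lin_ext_diff by simp
qed (simp_all add: boundary_single face_sum_def)

lemma block_cycle_swap:
  "even (length us) \<Longrightarrow> block_cycle U (us @ [b, a] @ vs) = - block_cycle U (us @ [a, b] @ vs)"
  by (induction U us rule: flag.induct) (simp_all add: insert_commute)

text \<open>For distinct entries, two consecutive vertices that add \<open>{x}\<close> and
  \<open>{x, y, z}\<close> to the preceding blocks occur together in exactly two of the six joins,
  those with first block \<open>{x, y}\<close> or \<open>{x, z}\<close>, and there with opposite
  signs.\<close>

lemma block_cycle_exchange:
  "even (length us) \<Longrightarrow>
    block_cycle U (us @ [a, b, c, d] @ vs) - block_cycle U (us @ [a, c, b, d] @ vs)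
    + block_cycle U (us @ [a, d, b, c] @ vs) + block_cycle U (us @ [b, c, a, d] @ vs)
    - block_cycle U (us @ [b, d, a, c] @ vs) + block_cycle U (us @ [c, d, a, b] @ vs) = 0"
proof (induction U us rule: flag.induct)
  case (1 U p q us)
  let ?C = "block_cycle (insert p (insert q U))"
  have "?C (us @ [a, b, c, d] @ vs) - ?C (us @ [a, c, b, d] @ vs)
    + ?C (us @ [a, d, b, c] @ vs) + ?C (us @ [b, c, a, d] @ vs)
    - ?C (us @ [b, d, a, c] @ vs) + ?C (us @ [c, d, a, b] @ vs) = 0"
    using 1 by simp
  then have "cone v (?C (us @ [a, b, c, d] @ vs)) - cone v (?C (us @ [a, c, b, d] @ vs))
    + cone v (?C (us @ [a, d, b, c] @ vs)) + cone v (?C (us @ [b, c, a, d] @ vs))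
    - cone v (?C (us @ [b, d, a, c] @ vs)) + cone v (?C (us @ [c, d, a, b] @ vs)) = 0" for v
    by (simp only: cone_simps(1) flip: cone_simps(2,3))
  from this[of "insert p U"] this[of "insert q U"] show ?case by (simp add: algebra_simps)
next
  case (3 U)
  show ?case by (simp add: insert_commute algebra_simps)
qed simp

section \<open>Leading terms\<close>

definition weight :: "nat set set \<Rightarrow> nat" where
  "weight \<sigma> = (\<Sum>F\<in>\<sigma>. \<Sum>F)"

text \<open>
  The two halves of the condition on an alternating permutation: \<open>x\<^sub>2\<^sub>i\<^sub>-\<^sub>1 < x\<^sub>2\<^sub>i\<close> inside the blocks
  and \<open>x\<^sub>2\<^sub>i > x\<^sub>2\<^sub>i\<^sub>+\<^sub>1\<close> between them.
\<close>

fun up :: "nat list \<Rightarrow> bool" where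
  "up (a # b # xs) \<longleftrightarrow> a < b \<and> up xs"
| "up [a] \<longleftrightarrow> True"
| "up [] \<longleftrightarrow> True"

fun down :: "nat list \<Rightarrow> bool" where
  "down (a # b # xs) \<longleftrightarrow> (xs \<noteq> [] \<longrightarrow> hd xs < b) \<and> down xs"
| "down [a] \<longleftrightarrow> True"
| "down [] \<longleftrightarrow> True"

lemma weight_insert:
  assumes "finite \<sigma>" "insert a U \<notin> \<sigma>" "finite U" "a \<notin> U"
  shows "weight (insert (insert a U) \<sigma>) = a + \<Sum>U + weight \<sigma>"
  using assms by (simp add: weight_def)

text \<open>Every later vertex contains both entries of an earlier block, so the choices in
  different blocks contribute independently to the weight. Taking the right entry instead of the
  left one costs \<open>b - a\<close>, which is positive by \<open>up\<close>.\<close>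

lemma block_cycle_leading:
  assumes "distinct xs" "set xs \<inter> U = {}" "even (length xs)" "finite U" "even (card U)" "up xs"
  shows "coeff (block_cycle U xs) (flag U xs) = 1 \<and>
    (\<forall>\<sigma>\<in>supp (block_cycle U xs). \<sigma> \<noteq> flag U xs \<longrightarrow> weight (flag U xs) < weight \<sigma>)"
  using assms
proof (induction U xs rule: flag.induct)
  case (1 U a b xs)
  let ?U = "insert a (insert b U)"
  let ?C = "block_cycle ?U xs" and ?f = "flag ?U xs"
  have ab: "a < b" "a \<notin> U" "b \<notin> U" "finite U" using "1.prems" by auto
  have hyps: "distinct xs" "set xs \<inter> ?U = {}" "even (length xs)" "finite ?U" "even (card ?U)" "up xs"
    using "1.prems" by auto
  have lead: "coeff ?C ?f = 1" "\<And>\<sigma>. \<sigma> \<in> supp ?C \<Longrightarrow> \<sigma> \<noteq> ?f \<Longrightarrow> weight ?f < weight \<sigma>"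
    using "1.IH"[OF hyps] by blast+
  have sub: "supp ?C \<subseteq> odd_chains ?U (?U \<union> set xs) (length xs div 2)"
    using hyps by (intro block_cycle_odd_chains) auto
  have fin: "finite \<sigma>" if "\<sigma> \<in> supp ?C" for \<sigma>
    using subsetD[OF sub that] by (simp add: odd_chains_def)
  have notin: "insert c U \<notin> \<sigma>" if "\<sigma> \<in> supp ?C" "c \<in> {a, b}" for c \<sigma>
    using subsetD[OF sub that(1)] that(2) unfolding odd_chains_def by blast
  have fC: "?f \<in> supp ?C" using lead(1) by (simp add: in_keys_iff)
  have ne: "insert b U \<noteq> insert a U" using ab by auto
  have nb: "insert b U \<notin> flag U (a # b # xs)" using ne notin[OF fC, of b] by simp
  have "flag U (a # b # xs) - {insert a U} = ?f" using notin[OF fC, of a] by auto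
  then have "coeff (cone (insert a U) ?C) (flag U (a # b # xs)) = 1"
    using lead(1) notin by (subst lookup_cone) auto
  moreover have "coeff (cone (insert b U) ?C) (flag U (a # b # xs)) = 0"
    using nb notin by (subst lookup_cone) auto
  moreover have "weight (flag U (a # b # xs)) < weight \<sigma>"
    if \<sigma>: "\<sigma> \<in> supp (block_cycle U (a # b # xs))" "\<sigma> \<noteq> flag U (a # b # xs)" for \<sigma>
  proof -
    obtain c \<tau> where c: "c \<in> {a, b}" and \<tau>: "\<tau> \<in> supp ?C" "\<sigma> = insert (insert c U) \<tau>"
      using \<sigma>(1) by (rule supp_block_cycle_Cons)
    have w: "weight \<sigma> = c + \<Sum>U + weight \<tau>"
      unfolding \<tau>(2) using c ab fin[OF \<tau>(1)] notin[OF \<tau>(1) c] by (intro weight_insert) auto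
    have w0: "weight (flag U (a # b # xs)) = a + \<Sum>U + weight ?f"
      using ab fin[OF fC] notin[OF fC, of a] by (simp add: weight_insert)
    show ?thesis
    proof (cases "\<tau> = ?f")
      case True
      then have "c = b" using \<sigma>(2) \<tau>(2) c by auto
      then show ?thesis using True ab(1) w w0 by simp
    next
      case False
      then show ?thesis using lead(2)[OF \<tau>(1)] w w0 c ab(1) by auto
    qed
  qed
  ultimately show ?case by (simp add: lookup_minus)
qed (simp_all add: lookup_single)

section \<open>Splitting a list at a block boundary\<close>

lemma flag_append:
  "even (length us) \<Longrightarrow> flag U (us @ vs) = flag U us \<union> flag (U \<union> set us) vs"
  by (induction U us rule: flag.induct) auto

lemma up_append: "even (length us) \<Longrightarrow> up (us @ vs) \<longleftrightarrow> up us \<and> up vs"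
  by (induction us rule: up.induct) auto

lemma down_append:
  "even (length us) \<Longrightarrow> down (us @ vs) \<longleftrightarrow>
    down us \<and> down vs \<and> (us \<noteq> [] \<longrightarrow> vs \<noteq> [] \<longrightarrow> hd vs < last us)"
  by (induction us rule: down.induct) auto

lemma not_up_split:
  assumes "even (length xs)" "distinct xs" "\<not> up xs"
  obtains us a b vs where "xs = us @ [a, b] @ vs" "even (length us)" "b < a"
proof -
  have "\<exists>us a b vs. xs = us @ [a, b] @ vs \<and> even (length us) \<and> b < a"
    using assms
  proof (induction xs rule: up.induct)
    case (1 a b xs)
    show ?case
    proof (cases "b < a")
      case True
      then have "a # b # xs = [] @ [a, b] @ xs \<and> even (length ([] :: nat list)) \<and> b < a" by simp
      then show ?thesis by blast
    next
      case False
      then have "\<not> up xs" using "1.prems" by auto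
      moreover have "even (length xs)" "distinct xs" using "1.prems" by simp_all
      ultimately obtain us c d vs where *: "xs = us @ [c, d] @ vs" "even (length us)" "d < c"
        using "1.IH" by blast
      then have "a # b # xs = (a # b # us) @ [c, d] @ vs \<and> even (length (a # b # us)) \<and> d < c" by simp
      then show ?thesis by blast
    qed
  qed auto
  then show thesis using that by blast
qed

lemma not_down_split:
  assumes "even (length xs)" "distinct xs" "\<not> down xs"
  obtains us a b c d vs where "xs = us @ [a, b, c, d] @ vs" "even (length us)" "b < c"
proof -
  have "\<exists>us a b c d vs. xs = us @ [a, b, c, d] @ vs \<and> even (length us) \<and> b < c"
    using assms
  proof (induction xs rule: down.induct)
    case (1 a b xs)
    show ?case
    proof (cases "down xs")
      case True
      then obtain c ys where "xs = c # ys" "b \<le> c" using "1.prems" by (cases xs) auto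
      moreover from this obtain d zs where "ys = d # zs" using "1.prems" by (cases ys) auto
      ultimately have "a # b # xs = [] @ [a, b, c, d] @ zs \<and> even (length ([] :: nat list)) \<and> b < c"
        using "1.prems" by auto
      then show ?thesis by blast
    next
      case False
      have "even (length xs)" "distinct xs" using "1.prems" by simp_all
      then obtain us a' b' c d vs where *: "xs = us @ [a', b', c, d] @ vs" "even (length us)" "b' < c"
        using "1.IH" False by blast
      then have "a # b # xs = (a # b # us) @ [a', b', c, d] @ vs \<and> even (length (a # b # us)) \<and> b' < c"
        by simp
      then show ?thesis by blast
    qed
  qed auto
  then show thesis using that by blast
qed

section \<open>Maximal chains of odd sets as flags\<close>

lemma odd_chains_mem:
  assumes "\<sigma> \<in> odd_chains U I k" "F \<in> \<sigma>"
  shows "U \<subset> F" "F \<subseteq> I" "odd (card F)"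
  using assms by (simp_all add: odd_chains_def)

lemma odd_chains_finite_mem:
  assumes "\<sigma> \<in> odd_chains U I k" "finite I" "F \<in> \<sigma>"
  shows "finite F"
  using odd_chains_mem(2)[OF assms(1,3)] assms(2) by (rule finite_subset)

lemma odd_chains_inj_card:
  assumes "\<sigma> \<in> odd_chains U I k" "finite I"
  shows "inj_on card \<sigma>"
  using assms odd_chains_finite_mem[OF assms] by (intro inj_on_card_chain) (simp_all add: odd_chains_def)

text \<open>The \<open>k\<close> members have distinct odd sizes in a range with just
  \<open>k\<close> values, so every value is attained. In particular, a vertex exchanged in a
  maximal chain keeps its size.\<close>

lemma odd_chains_card_image:
  assumes \<sigma>: "\<sigma> \<in> odd_chains U I k" and I: "finite I" "card I = 2 * l + 2 * k" "card U = 2 * l"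
  shows "card ` \<sigma> = {m. 2 * l < m \<and> m < 2 * l + 2 * k \<and> odd m}"
proof (rule card_subset_eq)
  show "card ` \<sigma> \<subseteq> {m. 2 * l < m \<and> m < 2 * l + 2 * k \<and> odd m}"
  proof
    fix m assume "m \<in> card ` \<sigma>"
    then obtain F where F: "F \<in> \<sigma>" "m = card F" by blast
    note F' = odd_chains_mem[OF \<sigma> F(1)]
    have "card U < card F"
      using finite_subset[OF F'(2) I(1)] F'(1) by (rule psubset_card_mono)
    moreover have "card F \<le> card I" using I(1) F'(2) by (rule card_mono)
    moreover have "card F \<noteq> card I"
    proof
      assume "card F = card I"
      then show False using F'(3) I(2) by simp
    qed
    ultimately show "m \<in> {m. 2 * l < m \<and> m < 2 * l + 2 * k \<and> odd m}"
      using F'(3) F(2) I by simp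
  qed
  have "card (card ` \<sigma>) = card \<sigma>" by (rule card_image[OF odd_chains_inj_card[OF \<sigma> I(1)]])
  then show "card (card ` \<sigma>) = card {m. 2 * l < m \<and> m < 2 * l + 2 * k \<and> odd m}"
    using \<sigma> by (simp add: card_odd_between odd_chains_def)
qed simp

lemma flag_least:
  assumes "distinct (a # b # xs)" "set (a # b # xs) \<inter> U = {}" "even (length xs)" "finite U" "even (card U)"
    and "F \<in> flag U (a # b # xs)"
  shows "F = insert a U \<or> card U + 2 < card F"
proof (cases "F = insert a U")
  case False
  let ?U = "insert a (insert b U)"
  have "flag ?U xs \<in> odd_chains ?U (?U \<union> set xs) (length xs div 2)"
    using assms by (intro flag_odd_chains) auto
  moreover have F: "F \<in> flag ?U xs" using assms False by simp
  ultimately have "?U \<subset> F" "finite F"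
    using odd_chains_mem(1) odd_chains_finite_mem assms(4) by blast+
  then have "card ?U < card F" by (intro psubset_card_mono)
  then show ?thesis using assms by simp
qed simp

text \<open>The flag shows the first entry and then two new entries at a time, whose order is fixed
  by \<open>down\<close>. The last entry is what remains of the underlying set.\<close>

lemma flag_down_inj:
  assumes "distinct xs" "set xs \<inter> U = {}" "even (length xs)" "finite U" "even (card U)" "down xs"
    and "distinct ys" "down ys" "set ys = set xs" "flag U ys = flag U xs"
  shows "ys = xs"
  using assms
proof (induction U xs arbitrary: ys rule: flag.induct)
  case (1 U a b xs)
  have len: "length ys = length (a # b # xs)"
    using "1.prems"(1,7,9) by (metis distinct_card)
  then obtain c d zs where ys: "ys = c # d # zs" "length zs = length xs"
    by (metis Suc_length_conv length_Cons)
  have U: "set (c # d # zs) \<inter> U = {}" "distinct (c # d # zs)" "even (length zs)"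
    using "1.prems" ys by simp_all
  have "insert a U \<in> flag U (c # d # zs)"
    using "1.prems"(10) ys(1) by simp
  from flag_least[OF U(2,1,3) "1.prems"(4,5) this] have "insert a U = insert c U"
    using "1.prems"(2,4) by auto
  then have ac: "c = a" using "1.prems"(2) U(1) by (metis Diff_insert_absorb IntI empty_iff insertI1 list.set_intros(1) singletonD insert_Diff_if)
  have nflag: "insert a U \<notin> flag (insert p (insert q U)) us"
    if "distinct (p # q # us)" "set (p # q # us) \<inter> U = {}" "even (length us)" "a \<in> {p, q}" for p q us
  proof
    assume F: "insert a U \<in> flag (insert p (insert q U)) us"
    have "flag (insert p (insert q U)) us \<in>
        odd_chains (insert p (insert q U)) (insert p (insert q U) \<union> set us) (length us div 2)"
      using that "1.prems"(4,5) by (intro flag_odd_chains) auto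
    from odd_chains_mem(1)[OF this F] have "insert p (insert q U) \<subset> insert a U" .
    then show False using that by auto
  qed
  have "flag (insert a (insert d U)) zs = flag (insert a (insert b U)) xs"
  proof -
    have "insert (insert a U) (flag (insert a (insert d U)) zs) = insert (insert a U) (flag (insert a (insert b U)) xs)"
      using "1.prems"(10) ys(1) ac by simp
    moreover have "insert a U \<notin> flag (insert a (insert b U)) xs"
      using "1.prems" by (intro nflag) auto
    moreover have "insert a U \<notin> flag (insert a (insert d U)) zs"
      using U ac by (intro nflag) auto
    ultimately show ?thesis by (metis insert_ident)
  qed
  note feq = this
  have bd: "d = b"
  proof (cases xs)
    case Nil
    then have "zs = []" using ys by simp
    then have "set ys = {a, d}" using ys ac by simp
    moreover have "set ys = {a, b}" using Nil "1.prems"(9) by simp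
    ultimately show ?thesis using U(2) ac by (auto simp: doubleton_eq_iff)
  next
    case (Cons p xs')
    then obtain q xs'' where xs: "xs = p # q # xs''" using "1.prems"(3) by (cases xs') auto
    then obtain r s zs'' where zs: "zs = r # s # zs''"
      using ys(2) by (metis Suc_length_conv length_Cons)
    let ?V = "insert a (insert b U)" and ?W = "insert a (insert d U)"
    have "insert p ?V \<in> flag ?W (r # s # zs'')" using feq xs zs by simp
    then have "insert p ?V = insert r ?W \<or> card ?W + 2 < card (insert p ?V)"
      using U ac zs "1.prems"(4,5) by (intro flag_least[of r s zs'']) auto
    moreover have "card (insert p ?V) = card U + 3" "card ?W = card U + 2"
      using U ac zs "1.prems"(1,2,4) xs by auto
    ultimately have eq: "insert p ?V = insert r ?W" by simp
    \<comment> \<open>Both \<open>b\<close> and \<open>d\<close> are the larger of the two elements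
      that the second vertex adds to the first.\<close>
    have "p < b" using "1.prems"(6) xs by simp
    moreover have "r < d" using "1.prems"(8) ys zs by simp
    moreover have "b \<in> insert r ?W" "d \<in> insert p ?V" using eq by blast+
    ultimately show ?thesis using "1.prems"(1,2) U ac by auto
  qed
  have "zs = xs"
  proof (rule "1.IH")
    show "set zs = set xs"
    proof -
      have "set (a # b # zs) = set (a # b # xs)" using "1.prems"(9) ys ac bd by simp
      moreover have "a \<notin> set zs" "b \<notin> set zs" "a \<notin> set xs" "b \<notin> set xs"
        using U(2) ac bd "1.prems"(1) by auto
      ultimately show ?thesis by auto
    qed
    show "down zs" using "1.prems"(8) ys by simp
    show "flag (insert a (insert b U)) zs = flag (insert a (insert b U)) xs" using feq bd by simp
  qed (use "1.prems" U in auto)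
  then show ?case using ys ac bd by simp
qed auto

text \<open>The list is read off from the smallest member upwards: \<open>a\<close> is the element
  that it adds to \<open>U\<close>, and \<open>b\<close> is the larger of the two elements added by
  the next member.\<close>

lemma flag_exists:
  assumes "finite I" "U \<subseteq> I" "card U = 2 * l" "card I = 2 * l + 2 * k" "\<sigma> \<in> odd_chains U I k"
  shows "\<exists>xs. distinct xs \<and> set xs = I - U \<and> down xs \<and> flag U xs = \<sigma>"
  using assms(2-)
proof (induction k arbitrary: l U \<sigma>)
  case 0
  have "U = I" using 0 assms(1) by (intro card_subset_eq) auto
  moreover have "\<sigma> = {}" using 0 by (auto simp: odd_chains_def)
  ultimately show ?case by (intro exI[of _ "[]"]) simp
next
  case (Suc k)
  note \<sigma> = Suc.prems(4)
  have fU: "finite U" using Suc.prems(1) assms(1) by (rule finite_subset)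
  have im: "card ` \<sigma> = {m. 2 * l < m \<and> m < 2 * l + 2 * Suc k \<and> odd m}"
    using \<sigma> assms(1) Suc.prems(3,2) by (rule odd_chains_card_image)
  have "2 * l + 1 \<in> card ` \<sigma>" unfolding im by simp
  then obtain F where F: "F \<in> \<sigma>" "card F = 2 * l + 1" by auto
  have fin: "finite G" if "G \<in> \<sigma>" for G using odd_chains_finite_mem[OF \<sigma> assms(1) that] .
  have chain: "chain_subset \<sigma>" and f\<sigma>: "finite \<sigma>" using \<sigma> by (simp_all add: odd_chains_def)
  have "card (F - U) = 1"
    using F(2) Suc.prems(2) odd_chains_mem(1)[OF \<sigma> F(1)] fU by (subst card_Diff_subset) auto
  then obtain a where "F - U = {a}" by (rule card_1_singletonE)
  then have a: "F = insert a U" "a \<notin> U" "a \<in> I"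
    using odd_chains_mem(1,2)[OF \<sigma> F(1)] by auto
  have rest: "F \<subset> G \<and> 2 * l + 3 \<le> card G" if G: "G \<in> \<sigma>" "G \<noteq> F" for G
  proof -
    have "card G \<noteq> card F" using odd_chains_inj_card[OF \<sigma> assms(1)] F(1) G by (auto simp: inj_on_def)
    moreover have "card G \<in> {m. 2 * l < m \<and> m < 2 * l + 2 * Suc k \<and> odd m}"
      using im G(1) by blast
    ultimately have "2 * l + 3 \<le> card G" using F(2) by (auto elim!: oddE)
    moreover then have "F \<subset> G"
      using F(2) by (intro chain_subset_card_less[OF chain F(1) G(1) fin[OF F(1)]]) simp
    ultimately show ?thesis by simp
  qed
  \<comment> \<open>The statement is phrased to cover the last block as well, where there is no next
    member and \<open>b\<close> is the remaining element of \<open>I\<close>.\<close>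
  have sub: "\<exists>b\<in>I. b \<notin> F \<and> (\<forall>G\<in>\<sigma> - {F}. insert a (insert b U) \<subset> G) \<and>
     (\<forall>G\<in>\<sigma> - {F}. card G = 2 * l + 3 \<longrightarrow> (\<forall>c\<in>G - F. c \<le> b))"
  proof (cases "\<sigma> = {F}")
    case True
    have "card F < card I" using F(2) Suc.prems(3) by simp
    then have "\<not> I \<subseteq> F" using card_mono[OF fin[OF F(1)], of I] by auto
    then show ?thesis using True by auto
  next
    case False
    then have "card \<sigma> \<noteq> 1" using F(1) by (auto simp: card_1_singleton_iff)
    then have "0 < k" using \<sigma> by (simp add: odd_chains_def)
    then have "2 * l + 3 \<in> card ` \<sigma>" unfolding im by simp
    then obtain G where G: "G \<in> \<sigma>" "card G = 2 * l + 3" by auto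
    have FG: "F \<subset> G" using rest[of G] G F(2) by auto
    define b where "b = Max (G - F)"
    have b: "b \<in> G - F" "\<And>c. c \<in> G - F \<Longrightarrow> c \<le> b"
      unfolding b_def using FG fin[OF G(1)] by (auto intro!: Max_in Max_ge simp del: Diff_iff)
    have abG: "insert a (insert b U) \<subset> G"
    proof -
      have "insert a (insert b U) \<subseteq> G" using FG a(1) b(1) by auto
      moreover have "card (insert a (insert b U)) \<noteq> card G"
        using G(2) Suc.prems(2) fU a b(1) by (simp add: card_insert_if)
      ultimately show ?thesis by auto
    qed
    have "insert a (insert b U) \<subset> H" if H: "H \<in> \<sigma> - {F}" for H
    proof (cases "H = G")
      case True
      then show ?thesis using abG by simp
    next
      case False
      have "card H \<noteq> card G" using odd_chains_inj_card[OF \<sigma> assms(1)] G(1) H False by (auto simp: inj_on_def)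
      then have "card G < card H" using rest[of H] H G(2) by auto
      then have "G \<subset> H" using H by (intro chain_subset_card_less[OF chain G(1) _ fin[OF G(1)]]) auto
      then show ?thesis using abG by blast
    qed
    moreover have "H = G" if "H \<in> \<sigma> - {F}" "card H = 2 * l + 3" for H
      using odd_chains_inj_card[OF \<sigma> assms(1)] that G by (auto simp: inj_on_def)
    ultimately show ?thesis
      using b odd_chains_mem(2)[OF \<sigma> G(1)] by (intro bexI[of _ b]) auto
  qed
  then obtain b where b: "b \<in> I" "b \<notin> F" "\<And>G. G \<in> \<sigma> - {F} \<Longrightarrow> insert a (insert b U) \<subset> G"
    and bmax: "\<And>G c. G \<in> \<sigma> - {F} \<Longrightarrow> card G = 2 * l + 3 \<Longrightarrow> c \<in> G - F \<Longrightarrow> c \<le> b"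
    by blast
  let ?U = "insert a (insert b U)"
  have cU: "card ?U = 2 * Suc l" using a b(2) fU Suc.prems(2) by simp
  have "\<sigma> - {F} \<in> odd_chains ?U I k"
    unfolding odd_chains_def
  proof (intro CollectI conjI ballI)
    show "finite (\<sigma> - {F})" using f\<sigma> by simp
    show "chain_subset (\<sigma> - {F})" using chain by (rule chain_subset_mono) blast
    show "card (\<sigma> - {F}) = k" using F(1) \<sigma> by (simp add: odd_chains_def)
    fix G assume G: "G \<in> \<sigma> - {F}"
    then show "?U \<subset> G" by (rule b(3))
    show "G \<subseteq> I" "odd (card G)" using G odd_chains_mem(2,3)[OF \<sigma>] by auto
  qed
  moreover have "?U \<subseteq> I" using a b Suc.prems(1) by simp
  ultimately obtain xs where xs: "distinct xs" "set xs = I - ?U" "down xs" "flag ?U xs = \<sigma> - {F}"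
    using Suc.IH[of ?U "Suc l" "\<sigma> - {F}"] cU Suc.prems(3) by auto
  \<comment> \<open>The head of \<open>xs\<close> is the other element added by the next member, the
    one of size \<open>2 * l + 3\<close>; maximality of \<open>b\<close> gives the
    inequality.\<close>
  have "xs \<noteq> [] \<longrightarrow> hd xs < b"
  proof
    assume "xs \<noteq> []"
    then obtain c ys where cys: "xs = c # ys" by (cases xs) auto
    have "card (I - ?U) = 2 * k"
      using \<open>?U \<subseteq> I\<close> cU Suc.prems(3) fU by (subst card_Diff_subset) auto
    then have "even (length xs)" using xs(1,2) by (metis distinct_card even_mult_iff even_numeral)
    then obtain d zs where xs': "xs = c # d # zs" using cys by (cases ys) auto
    then have G: "insert c ?U \<in> \<sigma> - {F}" using xs(4) by auto
    have c: "c \<notin> ?U" using xs(2) xs' by auto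
    then have "c \<le> b" using G cU fU a(1) by (intro bmax[of "insert c ?U"]) auto
    then show "hd xs < b" using c xs' by auto
  qed
  moreover have "distinct (a # b # xs)" "set (a # b # xs) = I - U"
    using xs(1,2) a b(1,2) by auto
  moreover have "flag U (a # b # xs) = \<sigma>" using xs(4) F(1) a(1) by auto
  ultimately show ?case using xs(3) by (intro exI[of _ "a # b # xs"]) simp
qed

section \<open>Surjectivity\<close>

lemma lin_ext_block_cycle_odd_chains:
  assumes "card I = 2 * k" "supp u \<subseteq> permutations_of_set I"
  shows "supp (lin_ext (block_cycle {}) u) \<subseteq> odd_chains {} I k"
    and "boundary (lin_ext (block_cycle {}) u) = 0"
proof -
  have *: "supp (block_cycle {} x) \<subseteq> odd_chains {} I k" "boundary (block_cycle {} x) = 0"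
    if "x \<in> supp u" for x
  proof -
    have x: "distinct x" "set x = I" using that assms(2) by (auto simp: permutations_of_set_def)
    then have len: "length x = 2 * k" using assms(1) by (simp flip: distinct_card)
    show "supp (block_cycle {} x) \<subseteq> odd_chains {} I k"
      using block_cycle_odd_chains[of x "{}" I] x len by simp
    show "boundary (block_cycle {} x) = 0"
      using x len by (intro boundary_block_cycle) auto
  qed
  show "supp (lin_ext (block_cycle {}) u) \<subseteq> odd_chains {} I k"
    using * by (intro order.trans[OF keys_lin_ext] UN_least)
  show "boundary (lin_ext (block_cycle {}) u) = 0"
    unfolding boundary_eq lin_ext_lin_ext using *(2) unfolding boundary_eq by (rule lin_ext_eq_0)
qed

text \<open>Common elements cancel, and the two differences have the same positive number of
  elements, separated by the gap between \<open>b\<close> and \<open>a\<close>.\<close>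

lemma sum_less_sum_exchange:
  fixes A B :: "nat set"
  assumes "finite A" "finite B" "card A = card B" "A \<noteq> B" "b < a"
    and "\<And>x. x \<in> A - B \<Longrightarrow> x \<le> b" "\<And>x. x \<in> B - A \<Longrightarrow> a \<le> x"
  shows "\<Sum>A < \<Sum>B"
proof -
  have card_eq: "card (A - B) = card (B - A)"
    using assms(1-3) card_Diff_subset_Int[of A B] card_Diff_subset_Int[of B A] by (simp add: Int_commute)
  have "\<not> A \<subseteq> B" using assms(2,3,4) card_subset_eq by blast
  then have pos: "0 < card (A - B)" using assms(1) by (auto simp: card_gt_0_iff)
  have "\<Sum>(A - B) \<le> card (A - B) * b"
    using sum_bounded_above[of "A - B" "\<lambda>x. x" b] assms(6) by simp
  also have "\<dots> < card (B - A) * a" using pos card_eq assms(5) by simp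
  also have "\<dots> \<le> \<Sum>(B - A)"
    using sum_bounded_below[of "B - A" a "\<lambda>x. x"] assms(7) by simp
  finally have "\<Sum>(A - B) < \<Sum>(B - A)" .
  moreover have "\<Sum>A = \<Sum>(A \<inter> B) + \<Sum>(A - B)" using assms(1) by (rule sum.Int_Diff)
  moreover have "\<Sum>B = \<Sum>(A \<inter> B) + \<Sum>(B - A)"
    using sum.Int_Diff[OF assms(2), of "\<lambda>x. x" A] by (simp add: Int_commute)
  ultimately show ?thesis by simp
qed

text \<open>
  If \<open>x\<^sub>2\<^sub>i\<^sub>-\<^sub>1 > x\<^sub>2\<^sub>i\<close>, then the vertex \<open>{x\<^sub>1, \<dots>, x\<^sub>2\<^sub>i\<^sub>-\<^sub>1}\<close> of the flag of \<open>x\<close> has the largest sum of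
  elements among all vertices that fit into its place.
\<close>

lemma up_if_lowest:
  assumes I: "finite I" "card I = 2 * k" and z: "boundary z = 0" "supp z \<subseteq> odd_chains {} I k"
    and x: "distinct x" "set x = I" "down x" and nz: "coeff z (flag {} x) \<noteq> 0"
    and lowest: "\<And>\<sigma>. weight \<sigma> < weight (flag {} x) \<Longrightarrow> coeff z \<sigma> = 0"
  shows "up x"
proof (rule ccontr)
  assume nup: "\<not> up x"
  have len: "length x = 2 * k" using x I(2) by (simp flip: distinct_card)
  then obtain us a b vs where split: "x = us @ [a, b] @ vs" "even (length us)" "b < a"
    using not_up_split[OF _ x(1) nup] by (metis dvd_triv_left)
  let ?\<sigma> = "flag {} x" and ?F = "insert a (set us)"
  have \<sigma>: "?\<sigma> \<in> odd_chains {} I k"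
    using flag_odd_chains[of x "{}" I] x len by simp
  have F\<sigma>: "?F \<in> ?\<sigma>" using split(1,2) by (simp add: flag_append)
  have fin\<sigma>: "finite ?\<sigma>" using \<sigma> by (simp add: odd_chains_def)
  \<comment> \<open>It suffices that the face opposite to \<open>?F\<close> has no other coface in
    \<open>z\<close>; any such coface will turn out to be of smaller weight.\<close>
  have "coeff z (insert ?F (?\<sigma> - {?F})) = 0"
  proof (rule unique_coface_zero[OF z(1)])
    fix v assume v: "v \<notin> ?\<sigma> - {?F}" "v \<noteq> ?F"
    show "coeff z (insert v (?\<sigma> - {?F})) = 0"
    proof (rule ccontr)
      let ?\<tau> = "insert v (?\<sigma> - {?F})"
      assume nz\<tau>: "coeff z ?\<tau> \<noteq> 0"
      then have \<tau>: "?\<tau> \<in> odd_chains {} I k" using z(2) by (auto simp: in_keys_iff)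
      have fv: "finite v" using odd_chains_finite_mem[OF \<tau> I(1)] by blast
      have vI: "v \<subseteq> I" using odd_chains_mem(2)[OF \<tau>, of v] by blast
      have cI: "card I = 2 * 0 + 2 * k" "card {} = 2 * 0" using I(2) by simp_all
      \<comment> \<open>Both chains use each admissible size exactly once, so \<open>v\<close> must
        have the size of \<open>?F\<close>.\<close>
      have "card ` ?\<tau> = card ` ?\<sigma>"
        using odd_chains_card_image[OF \<tau> I(1) cI] odd_chains_card_image[OF \<sigma> I(1) cI] by simp
      then have "card v \<in> card ` ?\<sigma>" by blast
      then obtain G where G: "G \<in> ?\<sigma>" "card v = card G" by blast
      have "G = ?F"
      proof (rule ccontr)
        assume "G \<noteq> ?F"
        then have "v = G" using odd_chains_inj_card[OF \<tau> I(1)] G unfolding inj_on_def by blast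
        then show False using v(1) G(1) \<open>G \<noteq> ?F\<close> by blast
      qed
      then have cv: "card v = card ?F" using G(2) by simp
      have chain: "chain_subset ?\<tau>" using \<tau> by (simp add: odd_chains_def)
      have cF: "card ?F = Suc (length us)"
        using x(1) split(1) by (simp add: distinct_card)
      \<comment> \<open>As \<open>v\<close> contains the preceding vertex of the flag, it can miss
        only \<open>a\<close> and the right entry \<open>r\<close> of the preceding block, and
        \<open>down\<close> gives \<open>a < r\<close>.\<close>
      have above: "a \<le> q" if q: "q \<in> ?F - v" for q
      proof (cases "q = a")
        case False
        then have "q \<in> set us" using q by simp
        then obtain ys r where us: "us = ys @ [r]" by (cases us rule: rev_cases) auto
        then obtain us' p where us: "us = us' @ [p, r]"
          using split(2) by (cases ys rule: rev_cases) auto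
        have "a < r"
        proof -
          have "down (us @ ([a, b] @ vs))" using x(3) split(1) by simp
          then have "hd ([a, b] @ vs) < last us" unfolding down_append[OF split(2)] using us by simp
          then show ?thesis using us by simp
        qed
        moreover have "insert p (set us') \<subseteq> v"
        proof -
          let ?V = "insert p (set us')"
          have "flag {} x = flag {} us' \<union> flag (set us') ([p, r] @ [a, b] @ vs)"
            using split(1,2) us by (simp add: flag_append)
          then have V\<sigma>: "?V \<in> ?\<sigma>" by simp
          have cV: "card ?V = Suc (length us')" using x(1) split(1) us by (simp add: distinct_card)
          then have "?V \<noteq> ?F" using cF us by auto
          then have "?V \<subset> v"
            using V\<sigma> cV cF cv us by (intro chain_subset_card_less[OF chain]) auto
          then show ?thesis by blast
        qed
        ultimately show ?thesis using q False us by auto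
      qed simp
      \<comment> \<open>As \<open>v\<close> lies in the following vertex of the flag, it can gain
        only \<open>b\<close> and the left entry \<open>c\<close> of the following block, and
        \<open>down\<close> gives \<open>c < b\<close>. In the last block only \<open>b\<close> is
        left.\<close>
      have below: "q \<le> b" if q: "q \<in> v - ?F" for q
      proof (cases vs)
        case Nil
        then have "I = insert b ?F" using x(2) split(1) by auto
        then show ?thesis using q vI by auto
      next
        case (Cons c ws)
        have "even (length x)" using len by simp
        then have "even (length vs)" using split(1,2) by simp
        then obtain d vs' where vs: "vs = c # d # vs'" using Cons by (cases ws) auto
        have "c < b" using x(3) split(1,2) vs by (simp add: down_append)
        moreover have "v \<subseteq> insert c (insert b ?F)"
        proof -
          let ?V = "insert c (insert b ?F)"
          have "?V \<in> ?\<sigma>" using split(1,2) vs by (simp add: flag_append insert_commute)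
          moreover have cV: "card ?V = Suc (Suc (Suc (length us)))"
            using x(1) split(1) vs by (simp add: distinct_card)
          moreover then have "?V \<noteq> ?F" using cF by auto
          ultimately have "v \<subset> ?V"
            using cF cv fv by (intro chain_subset_card_less[OF chain]) auto
          then show ?thesis by blast
        qed
        ultimately show ?thesis using q by auto
      qed
      have "\<Sum>v < \<Sum>?F"
        using fv cv v(2) split(3) below above by (intro sum_less_sum_exchange[of _ _ b a]) auto
      moreover have "weight ?\<tau> = \<Sum>v + weight (?\<sigma> - {?F})"
        using v fin\<sigma> by (simp add: weight_def)
      moreover have "weight ?\<sigma> = \<Sum>?F + weight (?\<sigma> - {?F})"
        unfolding weight_def using fin\<sigma> F\<sigma> by (rule sum.remove)
      ultimately have "weight ?\<tau> < weight ?\<sigma>" by simp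
      then show False using lowest nz\<tau> by blast
    qed
  qed (use fin\<sigma> in auto)
  then show False using nz F\<sigma> by (simp add: insert_absorb)
qed

lemma cycle_in_range:
  assumes I: "finite I" "card I = 2 * k" and z: "boundary z = 0" "supp z \<subseteq> odd_chains {} I k"
  shows "\<exists>u. supp u \<subseteq> permutations_of_set I \<and> lin_ext (block_cycle {}) u = z"
proof -
  have "odd_chains {} I k \<subseteq> Pow (Pow I)" by (auto simp: odd_chains_def)
  then have "finite (odd_chains {} I k)" by (rule finite_subset) (simp add: I(1))
  then have "finite (weight ` odd_chains {} I k)" by (rule finite_imageI)
  then have "\<exists>N. \<forall>n\<in>weight ` odd_chains {} I k. n < N" by (simp only: finite_nat_set_iff_bounded)
  then obtain N where N: "\<And>\<sigma>. \<sigma> \<in> odd_chains {} I k \<Longrightarrow> weight \<sigma> < N" by blast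
  \<comment> \<open>Here \<open>n\<close> counts the weight levels below the bound \<open>N\<close>
    that may still be occupied; for \<open>n = 0\<close> the support is empty.\<close>
  have "\<exists>u. supp u \<subseteq> permutations_of_set I \<and> lin_ext (block_cycle {}) u = z"
    if "boundary z = 0" "supp z \<subseteq> odd_chains {} I k" "\<And>\<sigma>. \<sigma> \<in> supp z \<Longrightarrow> N - n \<le> weight \<sigma>" for z n
    using that
  proof (induction n arbitrary: z)
    case 0
    have "\<sigma> \<notin> supp z" for \<sigma>
      using N[OF subsetD[OF 0(2)], of \<sigma>] 0(3)[of \<sigma>] by auto
    then have "z = 0" by (intro poly_mapping_eqI) (simp flip: not_in_keys_iff_lookup_eq_zero)
    then show ?case by (intro exI[of _ 0]) simp
  next
    case (Suc n)
    define m where "m = N - Suc n"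
    define S where "S = {\<sigma> \<in> supp z. weight \<sigma> = m}"
    have ex: "\<forall>\<sigma>\<in>S. \<exists>x. distinct x \<and> set x = I \<and> up x \<and> flag {} x = \<sigma>"
    proof
      fix \<sigma> assume that: "\<sigma> \<in> S"
      have \<sigma>: "\<sigma> \<in> odd_chains {} I k" using that Suc.prems(2) by (auto simp: S_def)
      then obtain x where x: "distinct x" "set x = I" "down x" "flag {} x = \<sigma>"
        using flag_exists[of I "{}" 0 k \<sigma>] I by auto
      have "up x"
      proof (rule up_if_lowest[OF I Suc.prems(1,2) x(1-3)])
        show "coeff z (flag {} x) \<noteq> 0" using that x(4) by (simp add: S_def in_keys_iff)
        fix \<rho> assume "weight \<rho> < weight (flag {} x)"
        then have "weight \<rho> < N - Suc n" using that x(4) by (simp add: S_def m_def)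
        then show "coeff z \<rho> = 0" using Suc.prems(3)[of \<rho>] by (auto simp: in_keys_iff)
      qed
      then show "\<exists>x. distinct x \<and> set x = I \<and> up x \<and> flag {} x = \<sigma>" using x by blast
    qed
    define word where "word \<sigma> = (SOME x. distinct x \<and> set x = I \<and> up x \<and> flag {} x = \<sigma>)" for \<sigma>
    have word: "distinct (word \<sigma>)" "set (word \<sigma>) = I" "up (word \<sigma>)" "flag {} (word \<sigma>) = \<sigma>"
      if "\<sigma> \<in> S" for \<sigma>
      using someI_ex[OF bspec[OF ex that]] by (simp_all only: word_def)
    define u0 where "u0 = (\<Sum>\<sigma>\<in>S. Poly_Mapping.single (word \<sigma>) (coeff z \<sigma>))"
    have "supp (Poly_Mapping.single (word \<sigma>) (coeff z \<sigma>)) \<subseteq> permutations_of_set I" if "\<sigma> \<in> S" for \<sigma>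
      using word(1,2)[OF that] by (simp add: permutations_of_set_def)
    then have u0: "supp u0 \<subseteq> permutations_of_set I"
      unfolding u0_def by (intro order.trans[OF keys_sum] UN_least)
    note c0 = lin_ext_block_cycle_odd_chains[OF I(2) u0]
    define z' where "z' = z - lin_ext (block_cycle {}) u0"
    \<comment> \<open>Up to weight \<open>m\<close> the cycle of \<open>word \<sigma>\<close>
      consists of \<sigma> alone, so subtracting these cycles clears level \<open>m\<close> and
      disturbs nothing below it.\<close>
    have lead: "coeff (block_cycle {} (word \<sigma>)) \<rho> = (if \<rho> = \<sigma> then 1 else 0)"
      if "\<sigma> \<in> S" "weight \<rho> \<le> m" for \<sigma> \<rho>
    proof -
      have "length (word \<sigma>) = 2 * k" using word(1,2)[OF that(1)] I(2) by (simp flip: distinct_card)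
      then have "coeff (block_cycle {} (word \<sigma>)) \<sigma> = 1 \<and>
          (\<forall>\<rho>\<in>supp (block_cycle {} (word \<sigma>)). \<rho> \<noteq> \<sigma> \<longrightarrow> weight \<sigma> < weight \<rho>)"
        using block_cycle_leading[of "word \<sigma>" "{}"] word[OF that(1)] by simp
      moreover have "weight \<sigma> = m" using that(1) by (simp add: S_def)
      ultimately show ?thesis using that(2) by (auto simp: in_keys_iff)
    qed
    have low: "coeff z' \<rho> = 0" if \<rho>: "weight \<rho> \<le> m" for \<rho>
    proof -
      have "coeff (lin_ext (block_cycle {}) u0) \<rho> =
          (\<Sum>\<sigma>\<in>S. coeff z \<sigma> * coeff (block_cycle {} (word \<sigma>)) \<rho>)"
        by (simp add: u0_def lin_ext_sum lookup_sum lookup_map_mult)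
      also have "\<dots> = (\<Sum>\<sigma>\<in>S. if \<rho> = \<sigma> then coeff z \<sigma> else 0)"
        using lead[OF _ \<rho>] by (intro sum.cong) auto
      also have "\<dots> = (if \<rho> \<in> S then coeff z \<rho> else 0)"
        by (simp add: S_def)
      also have "\<dots> = coeff z \<rho>"
      proof (cases "weight \<rho> = m")
        case False
        then have "\<not> N - Suc n \<le> weight \<rho>" using \<rho> by (simp add: m_def)
        then have "\<rho> \<notin> supp z" using Suc.prems(3) by blast
        then show ?thesis by (simp add: S_def in_keys_iff)
      qed (auto simp: S_def in_keys_iff)
      finally show ?thesis by (simp add: z'_def lookup_minus)
    qed
    have "\<exists>u. supp u \<subseteq> permutations_of_set I \<and> lin_ext (block_cycle {}) u = z'"
    proof (rule Suc.IH)
      show "boundary z' = 0"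
        using Suc.prems(1) c0(2) by (simp add: z'_def boundary_eq lin_ext_diff)
      show "supp z' \<subseteq> odd_chains {} I k"
        unfolding z'_def using Suc.prems(2) c0(1) by (intro order.trans[OF keys_diff] Un_least)
      fix \<sigma> assume "\<sigma> \<in> supp z'"
      then have "coeff z' \<sigma> \<noteq> 0" by (simp add: in_keys_iff)
      then have "m < weight \<sigma>" using low[of \<sigma>] by linarith
      then show "N - n \<le> weight \<sigma>" by (simp add: m_def)
    qed
    then obtain u where u: "supp u \<subseteq> permutations_of_set I" "lin_ext (block_cycle {}) u = z'" by blast
    show ?case
    proof (intro exI[of _ "u + u0"] conjI)
      show "supp (u + u0) \<subseteq> permutations_of_set I"
        using u(1) u0 by (intro order.trans[OF Poly_Mapping.keys_add] Un_least)
      show "lin_ext (block_cycle {}) (u + u0) = z"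
        using u(2) by (simp add: lin_ext_add z'_def)
    qed
  qed
  from this[OF z, of N] show ?thesis by simp
qed

section \<open>Straightening\<close>

text \<open>
  Straightening replaces a permutation by permutations of larger rank; for the exchange relation this
  needs that the weights of the right entries decrease from block to block.
\<close>

fun rank :: "nat list \<Rightarrow> nat" where
  "rank (a # b # xs) = (length xs + 2) * b + rank xs"
| "rank [a] = 0"
| "rank [] = 0"

lemma rank_append_less:
  "even (length us) \<Longrightarrow> length xs = length ys \<Longrightarrow> rank xs < rank ys \<Longrightarrow> rank (us @ xs) < rank (us @ ys)"
  by (induction us rule: rank.induct) auto

lemma rank_swap_less:
  assumes "b < a"
  shows "rank ([a, b] @ vs) < rank ([b, a] @ vs)"
proof -
  have "(length vs + 2) * b < (length vs + 2) * a" using assms by (intro mult_strict_left_mono) auto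
  then show ?thesis by simp
qed

text \<open>Only right entries count, which are \<open>b\<close> and \<open>d\<close> for the sorted
  word. All other words have a larger first right entry and no smaller sum of the two; for
  \<open>[c, d, a, b]\<close> the sums agree, and the strictly larger factor of the first block
  decides.\<close>

lemma rank_exchange_less:
  assumes "a < b" "b < c" "c < d"
  shows "rank ([a, b, c, d] @ vs) < rank ([a, c, b, d] @ vs)"
    and "rank ([a, b, c, d] @ vs) < rank ([a, d, b, c] @ vs)"
    and "rank ([a, b, c, d] @ vs) < rank ([b, c, a, d] @ vs)"
    and "rank ([a, b, c, d] @ vs) < rank ([b, d, a, c] @ vs)"
    and "rank ([a, b, c, d] @ vs) < rank ([c, d, a, b] @ vs)"
proof -
  define n where "n = length vs + 2"
  have n: "0 < n" by (simp add: n_def)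
  have less: "(n + 2) * p + n * q < (n + 2) * p' + n * q'" if "p < p'" "p + q \<le> p' + q'" for p q p' q'
  proof -
    have "n * (p + q) \<le> n * (p' + q')" using that(2) by simp
    then show ?thesis using that(1) by (simp add: algebra_simps)
  qed
  have r: "rank ([x, y, z, w] @ vs) = (n + 2) * y + n * w + rank vs" for x y z w
    by (simp add: n_def)
  show "rank ([a, b, c, d] @ vs) < rank ([a, c, b, d] @ vs)"
    "rank ([a, b, c, d] @ vs) < rank ([a, d, b, c] @ vs)"
    "rank ([a, b, c, d] @ vs) < rank ([b, c, a, d] @ vs)"
    "rank ([a, b, c, d] @ vs) < rank ([b, d, a, c] @ vs)"
    "rank ([a, b, c, d] @ vs) < rank ([c, d, a, b] @ vs)"
    unfolding r using assms less[of b c d d] less[of b d d c] less[of b d d b] by auto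
qed

section \<open>The submodule of relations\<close>

lemma permutations_of_set_mset_eq:
  assumes "x \<in> permutations_of_set I" "mset y = mset x"
  shows "y \<in> permutations_of_set I"
proof (rule permutations_of_setI)
  show "set y = I" using mset_eq_setD[OF assms(2)] assms(1) by (simp add: permutations_of_set_def)
  show "distinct y" using mset_eq_imp_distinct_iff[OF assms(2)] assms(1) by (simp add: permutations_of_set_def)
qed

lemma relation_submodule_submodule:
  "submodule (relation_submodule I) rat_field (free_module (permutations_of_set I))"
proof -
  interpret module rat_field "free_module (permutations_of_set I)" by (rule module_free_module)
  have "swap_relations I \<subseteq> {c. supp c \<subseteq> permutations_of_set I}"
  proof
    fix r assume "r \<in> swap_relations I"
    then obtain us a b vs where r: "r = Poly_Mapping.single (us @ [a, b] @ vs) 1 + Poly_Mapping.single (us @ [b, a] @ vs) 1"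
      and p: "us @ [a, b] @ vs \<in> permutations_of_set I" unfolding swap_relations_def by blast
    have "us @ [b, a] @ vs \<in> permutations_of_set I"
      using p by (rule permutations_of_set_mset_eq) simp
    then show "r \<in> {c. supp c \<subseteq> permutations_of_set I}"
      using p unfolding r mem_Collect_eq by (intro order.trans[OF Poly_Mapping.keys_add]) simp
  qed
  moreover have "exchange_relations I \<subseteq> {c. supp c \<subseteq> permutations_of_set I}"
  proof
    fix r assume "r \<in> exchange_relations I"
    then obtain us a b c d vs where r: "r = Poly_Mapping.single (us @ [a, b, c, d] @ vs) 1
         - Poly_Mapping.single (us @ [a, c, b, d] @ vs) 1
         + Poly_Mapping.single (us @ [a, d, b, c] @ vs) 1
         + Poly_Mapping.single (us @ [b, c, a, d] @ vs) 1
         - Poly_Mapping.single (us @ [b, d, a, c] @ vs) 1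
         + Poly_Mapping.single (us @ [c, d, a, b] @ vs) 1"
      and p: "us @ [a, b, c, d] @ vs \<in> permutations_of_set I" unfolding exchange_relations_def by blast
    have "us @ [a, c, b, d] @ vs \<in> permutations_of_set I" "us @ [a, d, b, c] @ vs \<in> permutations_of_set I"
      "us @ [b, c, a, d] @ vs \<in> permutations_of_set I" "us @ [b, d, a, c] @ vs \<in> permutations_of_set I"
      "us @ [c, d, a, b] @ vs \<in> permutations_of_set I"
      using p by (rule permutations_of_set_mset_eq; simp)+
    then show "r \<in> {c. supp c \<subseteq> permutations_of_set I}"
      using p unfolding r mem_Collect_eq
      by (intro order.trans[OF Poly_Mapping.keys_add] order.trans[OF keys_diff] Un_least) simp_all
  qed
  ultimately show ?thesis
    unfolding relation_submodule_def perm_module_def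
    by (intro submodule_generated) (auto simp: carrier_free_module)
qed

lemma
  shows zero_relation_submodule: "0 \<in> relation_submodule I"
    and add_relation_submodule: "c \<in> relation_submodule I \<Longrightarrow> d \<in> relation_submodule I \<Longrightarrow> c + d \<in> relation_submodule I"
    and scale_relation_submodule: "c \<in> relation_submodule I \<Longrightarrow> scale a c \<in> relation_submodule I"
    and keys_relation_submodule: "c \<in> relation_submodule I \<Longrightarrow> supp c \<subseteq> permutations_of_set I"
proof -
  interpret module rat_field "free_module (permutations_of_set I)" by (rule module_free_module)
  interpret N: submodule "relation_submodule I" rat_field "free_module (permutations_of_set I)"
    by (rule relation_submodule_submodule)
  note E = submoduleE[OF relation_submodule_submodule[of I]]
  show "c + d \<in> relation_submodule I" if "c \<in> relation_submodule I" "d \<in> relation_submodule I"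
    using E(5)[OF that] by simp
  show sc: "scale a c \<in> relation_submodule I" if "c \<in> relation_submodule I" for a c
    using E(4)[of a c] that by simp
  show "supp c \<subseteq> permutations_of_set I" if "c \<in> relation_submodule I"
    using subsetD[OF E(1) that] by (simp add: carrier_free_module)
  obtain c where "c \<in> relation_submodule I" using E(2) by blast
  then show "0 \<in> relation_submodule I" using sc[of c 0] by simp
qed

lemma sum_relation_submodule:
  "(\<And>x. x \<in> A \<Longrightarrow> f x \<in> relation_submodule I) \<Longrightarrow> sum f A \<in> relation_submodule I"
  by (induction A rule: infinite_finite_induct) (auto simp: zero_relation_submodule add_relation_submodule)

lemma generators_in_relation_submodule:
  "swap_relations I \<union> exchange_relations I \<subseteq> relation_submodule I"
  unfolding relation_submodule_def by (rule generated_submodule_incl)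

section \<open>Reduction to alternating permutations and the kernel\<close>

definition alternating :: "nat set \<Rightarrow> nat list set" where
  "alternating I = {x \<in> permutations_of_set I. up x \<and> down x}"

text \<open>Linear extension of a reduction known for single permutations. It also serves inside the
  induction for one permutation, since a relation replaces it by a combination of several.\<close>

lemma straighten_comb:
  assumes "\<And>x. x \<in> supp u \<Longrightarrow> \<exists>w. supp w \<subseteq> S \<and> Poly_Mapping.single x 1 - w \<in> relation_submodule I"
  shows "\<exists>w. supp w \<subseteq> S \<and> u - w \<in> relation_submodule I"
proof -
  define W where "W x = (SOME w. supp w \<subseteq> S \<and> Poly_Mapping.single x 1 - w \<in> relation_submodule I)" for x
  have W: "supp (W x) \<subseteq> S" "Poly_Mapping.single x 1 - W x \<in> relation_submodule I" if "x \<in> supp u" for x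
    using someI_ex[OF assms[OF that]] by (simp_all only: W_def)
  show ?thesis
  proof (intro exI[of _ "lin_ext W u"] conjI)
    show "supp (lin_ext W u) \<subseteq> S"
      using W(1) by (intro order.trans[OF keys_lin_ext] UN_least)
    have "u - lin_ext W u = lin_ext (\<lambda>x. Poly_Mapping.single x 1) u - lin_ext W u"
      by (simp only: lin_ext_single_id)
    also have "\<dots> = (\<Sum>x\<in>supp u. scale (coeff u x) (Poly_Mapping.single x 1 - W x))"
      unfolding lin_ext_def by (simp only: scale_diff sum_subtractf)
    finally show "u - lin_ext W u \<in> relation_submodule I"
      using W(2) by (simp only: sum_relation_submodule scale_relation_submodule)
  qed
qed

lemma straighten_single:
  assumes I: "finite I" "even (card I)" and x: "x \<in> permutations_of_set I"
  shows "\<exists>w. supp w \<subseteq> alternating I \<and> Poly_Mapping.single x 1 - w \<in> relation_submodule I"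
proof -
  have "finite (rank ` permutations_of_set I)" using I(1) by simp
  then obtain N where N: "\<And>y. y \<in> permutations_of_set I \<Longrightarrow> rank y < N"
    by (auto simp: finite_nat_set_iff_bounded)
  show ?thesis
    using x
  proof (induction "N - rank x" arbitrary: x rule: less_induct)
    case less
    have IH: "\<exists>w. supp w \<subseteq> alternating I \<and> Poly_Mapping.single y 1 - w \<in> relation_submodule I"
      if "y \<in> permutations_of_set I" "rank x < rank y" for y
      using that N[OF that(1)] by (intro less.hyps) auto
    \<comment> \<open>If subtracting a relation from \<open>x\<close> leaves only terms of higher
      rank, these are straightened by induction, and the relation itself is absorbed by the
      submodule.\<close>
    have step: ?case
      if r: "r \<in> relation_submodule I"
        and ry: "supp (Poly_Mapping.single x 1 - r) \<subseteq> {y \<in> permutations_of_set I. rank x < rank y}" for r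
    proof -
      have "\<exists>w. supp w \<subseteq> alternating I \<and> (Poly_Mapping.single x 1 - r) - w \<in> relation_submodule I"
      proof (rule straighten_comb)
        fix y assume "y \<in> supp (Poly_Mapping.single x 1 - r)"
        then have "y \<in> {y \<in> permutations_of_set I. rank x < rank y}" by (rule subsetD[OF ry])
        then show "\<exists>w. supp w \<subseteq> alternating I \<and> Poly_Mapping.single y 1 - w \<in> relation_submodule I"
          by (intro IH) simp_all
      qed
      then obtain w where w: "supp w \<subseteq> alternating I" "(Poly_Mapping.single x 1 - r) - w \<in> relation_submodule I"
        by blast
      have "((Poly_Mapping.single x 1 - r) - w) + r \<in> relation_submodule I"
        using w(2) r by (rule add_relation_submodule)
      then have "Poly_Mapping.single x 1 - w \<in> relation_submodule I" by (simp add: algebra_simps)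
      then show ?thesis using w(1) by blast
    qed
    have dx: "distinct x" "set x = I" using less.prems by (auto simp: permutations_of_set_def)
    then have len: "even (length x)" using I(2) by (simp flip: distinct_card)
    have perm: "y \<in> permutations_of_set I" if "mset y = mset x" for y
      using less.prems that by (rule permutations_of_set_mset_eq)
    show ?case
    proof (cases "up x")
      case False
      then obtain us a b vs where s: "x = us @ [a, b] @ vs" "even (length us)" "b < a"
        using not_up_split[OF len dx(1)] by blast
      let ?y = "us @ [b, a] @ vs"
      let ?r = "Poly_Mapping.single x (1::rat) + Poly_Mapping.single ?y 1"
      have "?r \<in> swap_relations I"
        using less.prems s(2) unfolding s(1) swap_relations_def by blast
      then have "?r \<in> relation_submodule I" using generators_in_relation_submodule by blast
      moreover have "rank x < rank ?y"
        unfolding s(1) using s(2,3) by (intro rank_append_less rank_swap_less) auto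
      moreover have "?y \<in> permutations_of_set I" by (rule perm) (simp add: s(1))
      ultimately show ?thesis by (intro step[of ?r]) (auto simp: single_uminus[symmetric])
    next
      case True
      show ?thesis
      proof (cases "down x")
        case False
        then obtain us a b c d vs where s: "x = us @ [a, b, c, d] @ vs" "even (length us)" "b < c"
          using not_down_split[OF len dx(1)] by blast
        \<comment> \<open>With \<open>up\<close> already secured, the failure \<open>b < c\<close>
          of \<open>down\<close> means that the four entries are sorted, as
          \<open>rank_exchange_less\<close> demands.\<close>
        have lt: "a < b" "c < d" using True s(1,2) by (simp_all add: up_append)
        let ?y = "\<lambda>ys. us @ ys @ vs"
        let ?s = "\<lambda>ys. Poly_Mapping.single (?y ys) (1::rat)"
        let ?r = "?s [a, b, c, d] - ?s [a, c, b, d] + ?s [a, d, b, c] + ?s [b, c, a, d]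
          - ?s [b, d, a, c] + ?s [c, d, a, b]"
        have "?r \<in> exchange_relations I"
          using less.prems s(2) unfolding s(1) exchange_relations_def by blast
        then have r: "?r \<in> relation_submodule I" using generators_in_relation_submodule by blast
        have y: "supp (?s ys) \<subseteq> {y \<in> permutations_of_set I. rank x < rank y}"
          if "ys \<in> {[a, c, b, d], [a, d, b, c], [b, c, a, d], [b, d, a, c], [c, d, a, b]}" for ys
        proof -
          have "?y ys \<in> permutations_of_set I" using that by (intro perm) (auto simp: s(1))
          moreover have "rank x < rank (?y ys)"
            unfolding s(1) using s(2) that rank_exchange_less[OF lt(1) s(3) lt(2)]
            by (intro rank_append_less) auto
          ultimately show ?thesis by simp
        qed
        have "Poly_Mapping.single x 1 - ?r =
          ?s [a, c, b, d] - ?s [a, d, b, c] - ?s [b, c, a, d] + ?s [b, d, a, c] - ?s [c, d, a, b]"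
          by (simp add: s(1))
        also have "supp \<dots> \<subseteq> {y \<in> permutations_of_set I. rank x < rank y}"
          by (intro order.trans[OF keys_diff] order.trans[OF Poly_Mapping.keys_add] Un_least y) simp_all
        finally show ?thesis by (rule step[OF r])
      next
        case dn: True
        have "supp (Poly_Mapping.single x (1::rat)) \<subseteq> alternating I"
          using True dn less.prems by (simp add: alternating_def)
        then show ?thesis
          by (intro exI[of _ "Poly_Mapping.single x 1"]) (simp add: zero_relation_submodule)
      qed
    qed
  qed
qed

text \<open>Let \<open>x\<close> have the flag of least weight. No other cycle in the combination
  contains this flag: its own flag is different by \<open>flag_down_inj\<close>, and all its further
  simplices weigh more. So the coefficient of \<open>x\<close> survives.\<close>

lemma alternating_independent:
  assumes I: "finite I" "card I = 2 * k" and w: "supp w \<subseteq> alternating I" "lin_ext (block_cycle {}) w = 0"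
  shows "w = 0"
proof (rule ccontr)
  assume "w \<noteq> 0"
  then have ne: "supp w \<noteq> {}"
    using poly_mapping_eqI[of w 0] by (auto simp flip: not_in_keys_iff_lookup_eq_zero)
  define x where "x = arg_min_on (\<lambda>x. weight (flag {} x)) (supp w)"
  have x: "x \<in> supp w" "\<And>y. y \<in> supp w \<Longrightarrow> weight (flag {} x) \<le> weight (flag {} y)"
    using arg_min_if_finite(1)[OF finite_keys ne] arg_min_least[OF finite_keys ne]
    by (simp_all only: x_def)
  have alt: "distinct y" "set y = I" "even (length y)" "up y" "down y" if "y \<in> supp w" for y
  proof -
    have "y \<in> alternating I" using w(1) that by (rule subsetD)
    then show "distinct y" "set y = I" "up y" "down y"
      by (auto simp: alternating_def permutations_of_set_def)
    then show "even (length y)" using I(2) by (simp flip: distinct_card)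
  qed
  have lead: "coeff (block_cycle {} y) (flag {} y) = 1"
    "\<And>\<sigma>. \<sigma> \<in> supp (block_cycle {} y) \<Longrightarrow> \<sigma> \<noteq> flag {} y \<Longrightarrow> weight (flag {} y) < weight \<sigma>"
    if "y \<in> supp w" for y
    using block_cycle_leading[of y "{}"] alt[OF that] by simp_all
  have "coeff (lin_ext (block_cycle {}) w) (flag {} x) =
      (\<Sum>y\<in>supp w. coeff w y * coeff (block_cycle {} y) (flag {} x))"
    by (rule lookup_lin_ext)
  also have "\<dots> = (\<Sum>y\<in>supp w. if y = x then coeff w y else 0)"
  proof (rule sum.cong[OF refl])
    fix y assume y: "y \<in> supp w"
    show "coeff w y * coeff (block_cycle {} y) (flag {} x) = (if y = x then coeff w y else 0)"
    proof (cases "y = x")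
      case True
      then show ?thesis using lead(1)[OF x(1)] by simp
    next
      case False
      have "flag {} x \<noteq> flag {} y"
        using flag_down_inj[of x "{}" y] alt[OF x(1)] alt[OF y] False by auto
      then have "flag {} x \<notin> supp (block_cycle {} y)"
        using lead(2)[OF y, of "flag {} x"] x(2)[OF y] by auto
      then show ?thesis using False by (simp add: in_keys_iff)
    qed
  qed
  also have "\<dots> = coeff w x" by (simp add: in_keys_iff)
  finally show False using w(2) x(1) by (simp add: in_keys_iff)
qed

text \<open>That relations map to zero is checked on generators. Conversely, \<open>u\<close> is
  congruent to an alternating combination \<open>w\<close>; if \<open>u\<close> maps to zero, so
  does \<open>w\<close>, which then vanishes by independence.\<close>

lemma relation_submodule_kernel:
  assumes I: "finite I" "card I = 2 * k" and u: "supp u \<subseteq> permutations_of_set I"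
  shows "lin_ext (block_cycle {}) u = 0 \<longleftrightarrow> u \<in> relation_submodule I"
proof -
  have ker: "lin_ext (block_cycle {}) r = 0" if r: "r \<in> relation_submodule I" for r
  proof -
    let ?K = "{c. supp c \<subseteq> permutations_of_set I \<and> lin_ext (block_cycle {}) c = 0}"
    have "submodule ?K rat_field (free_module (permutations_of_set I))"
    proof (rule submodule_free_moduleI)
      fix c d :: "nat list \<Rightarrow>\<^sub>0 rat" assume "c \<in> ?K" "d \<in> ?K"
      then show "c + d \<in> ?K"
        using Poly_Mapping.keys_add[of c d] by (auto simp: lin_ext_add)
    next
      fix a and c :: "nat list \<Rightarrow>\<^sub>0 rat" assume "c \<in> ?K"
      then show "scale a c \<in> ?K" using keys_scale[of a c] by (auto simp: lin_ext_scale)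
    qed auto
    moreover have "swap_relations I \<union> exchange_relations I \<subseteq> ?K"
    proof
      fix c assume c: "c \<in> swap_relations I \<union> exchange_relations I"
      then have "supp c \<subseteq> permutations_of_set I"
        using generators_in_relation_submodule keys_relation_submodule by blast
      moreover have "lin_ext (block_cycle {}) c = 0"
        using c
      proof
        assume "c \<in> swap_relations I"
        then obtain us a b vs where "even (length us)"
          "c = Poly_Mapping.single (us @ [a, b] @ vs) 1 + Poly_Mapping.single (us @ [b, a] @ vs) 1"
          unfolding swap_relations_def by blast
        then show ?thesis
          using block_cycle_swap[of us "{}" b a vs] by (simp add: lin_ext_add)
      next
        assume "c \<in> exchange_relations I"
        then obtain us a b c' d vs where "even (length us)"
          "c = Poly_Mapping.single (us @ [a, b, c', d] @ vs) 1
           - Poly_Mapping.single (us @ [a, c', b, d] @ vs) 1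
           + Poly_Mapping.single (us @ [a, d, b, c'] @ vs) 1
           + Poly_Mapping.single (us @ [b, c', a, d] @ vs) 1
           - Poly_Mapping.single (us @ [b, d, a, c'] @ vs) 1
           + Poly_Mapping.single (us @ [c', d, a, b] @ vs) 1"
          unfolding exchange_relations_def by blast
        then show ?thesis
          using block_cycle_exchange[of us "{}" a b c' d vs] by (simp add: lin_ext_add lin_ext_diff)
      qed
      ultimately show "c \<in> ?K" by simp
    qed
    ultimately have "relation_submodule I \<subseteq> ?K"
      unfolding relation_submodule_def perm_module_def generated_submodule_def by blast
    then show ?thesis using r by blast
  qed
  show ?thesis
  proof
    assume u0: "lin_ext (block_cycle {}) u = 0"
    have "\<exists>w. supp w \<subseteq> alternating I \<and> u - w \<in> relation_submodule I"
    proof (rule straighten_comb)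
      fix x assume "x \<in> supp u"
      then have "x \<in> permutations_of_set I" by (rule subsetD[OF u])
      then show "\<exists>w. supp w \<subseteq> alternating I \<and> Poly_Mapping.single x 1 - w \<in> relation_submodule I"
        using I by (intro straighten_single) simp_all
    qed
    then obtain w where w: "supp w \<subseteq> alternating I" "u - w \<in> relation_submodule I" by blast
    have "lin_ext (block_cycle {}) w = 0"
      using ker[OF w(2)] u0 by (simp add: lin_ext_diff)
    then have "w = 0" using w(1) by (intro alternating_independent[OF I])
    then show "u \<in> relation_submodule I" using w(2) by simp
  qed (rule ker)
qed

section \<open>The isomorphism\<close>

lemma boundary_in_complex:
  assumes "supp d \<subseteq> {\<sigma> \<in> K. card \<sigma> = Suc p}" "\<And>\<sigma> \<tau>. \<sigma> \<in> K \<Longrightarrow> \<tau> \<subseteq> \<sigma> \<Longrightarrow> \<tau> \<in> K"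
  shows "supp (boundary d) \<subseteq> {\<sigma> \<in> K. card \<sigma> = p}"
proof
  fix \<tau> assume "\<tau> \<in> supp (boundary d)"
  then have "\<tau> \<in> (\<Union>\<sigma>\<in>supp d. (\<lambda>v. \<sigma> - {v}) ` \<sigma>)" by (rule subsetD[OF keys_boundary])
  then obtain \<sigma> v where \<sigma>: "\<sigma> \<in> supp d" "v \<in> \<sigma>" "\<tau> = \<sigma> - {v}" by blast
  then have "\<sigma> \<in> K" "card \<sigma> = Suc p" using assms(1) by auto
  then show "\<tau> \<in> {\<sigma> \<in> K. card \<sigma> = p}" using \<sigma> assms(2)[of \<sigma> \<tau>] by auto
qed

theorem theorem3p6:
  fixes n k :: nat and I :: "nat set"
  assumes "I \<subseteq> {1..n + 1}" and "card I = 2 * k"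
  shows "module_isomorphic rat_field
    (quotient_module (perm_module I) (relation_submodule I))
    (reduced_homology (complex_A_sub n I) (int k - 1))"
proof -
  define V where "V = {J. J \<noteq> {} \<and> J \<subset> {1..n + 1} \<and> odd (card (J \<inter> I))}"
  define K where "K = complex_A_sub n I"
  have K: "K = {\<sigma>. \<sigma> \<subseteq> V \<and> chain_subset \<sigma>}"
    by (auto simp: K_def V_def complex_A_sub_def full_subcomplex_def complex_A_def)
  define f where "f = lin_ext (block_cycle {})"
  have I: "finite I" "card I = 2 * k" using assms finite_subset by auto
  have "V \<subseteq> Pow {1..n + 1}" by (auto simp: V_def)
  then have V: "finite V" "\<And>J. J \<in> V \<Longrightarrow> finite J"
    using finite_subset[of V] finite_subset[of _ "{1..n + 1}"] by blast+
  \<comment> \<open>Since \<open>card I\<close> is even, parity makes \<open>J\<close> a proper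
    subset of \<open>I\<close>, hence a vertex even when \<open>I\<close> is all of
    \<open>{1..n + 1}\<close>.\<close>
  have oddV: "J \<in> V" if "J \<subseteq> I" "odd (card J)" for J
  proof -
    have "J \<noteq> I" using that(2) I(2) by auto
    then show ?thesis using that assms(1) by (auto simp: V_def Int_absorb2)
  qed
  have VI: "J \<inter> I \<in> V" if "J \<in> V" for J using that by (intro oddV) (auto simp: V_def)
  have face_K: "\<tau> \<in> K" if "\<sigma> \<in> K" "\<tau> \<subseteq> \<sigma>" for \<sigma> \<tau>
    using that chain_subset_mono[of \<sigma> \<tau>] unfolding K by blast
  have odd_K: "odd_chains {} I k = {\<sigma> \<in> K. card \<sigma> = k \<and> \<sigma> \<subseteq> Pow I}"
  proof (intro equalityI subsetI)
    fix \<sigma> assume "\<sigma> \<in> odd_chains {} I k"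
    then show "\<sigma> \<in> {\<sigma> \<in> K. card \<sigma> = k \<and> \<sigma> \<subseteq> Pow I}" using oddV by (auto simp: odd_chains_def K)
  next
    fix \<sigma> assume \<sigma>: "\<sigma> \<in> {\<sigma> \<in> K. card \<sigma> = k \<and> \<sigma> \<subseteq> Pow I}"
    have "{} \<subset> F \<and> F \<subseteq> I \<and> odd (card F)" if "F \<in> \<sigma>" for F
    proof -
      have "F \<in> V" "F \<subseteq> I" using \<sigma> that by (auto simp: K)
      then show ?thesis by (auto simp: V_def Int_absorb2)
    qed
    moreover have "finite \<sigma>" using \<sigma> V(1) by (auto simp: K intro: finite_subset)
    ultimately show "\<sigma> \<in> odd_chains {} I k" using \<sigma> by (simp add: odd_chains_def K)
  qed
  \<comment> \<open>Degree \<open>q - 1\<close> means \<open>q\<close> vertices; as degrees are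
    integers, this includes \<open>q = 0\<close>, needed when \<open>I\<close> is empty.\<close>
  have chains: "simplicial_chains K (int q - 1) = free_module {\<sigma> \<in> K. card \<sigma> = q}" for q
    by (simp add: simplicial_chains_def)
  define C where "C = free_module {\<sigma> \<in> K. card \<sigma> = k}"
  define Z where "Z = cycles K (int k - 1)"
  define B where "B = boundaries K (int k - 1)"
  have Z: "c \<in> Z \<longleftrightarrow> supp c \<subseteq> {\<sigma> \<in> K. card \<sigma> = k} \<and> boundary c = 0" for c
    by (simp add: Z_def cycles_def chains carrier_free_module)
  have B: "c \<in> B \<longleftrightarrow> (\<exists>d. supp d \<subseteq> {\<sigma> \<in> K. card \<sigma> = Suc k} \<and> c = boundary d)" for c
    using chains[of "Suc k"] by (simp add: B_def boundaries_def carrier_free_module image_def Bex_def)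
  have BZ: "B \<subseteq> Z"
  proof
    fix c assume "c \<in> B"
    then obtain d where d: "supp d \<subseteq> {\<sigma> \<in> K. card \<sigma> = Suc k}" "c = boundary d" using B by blast
    have "boundary c = 0"
      unfolding d(2)
    proof (rule boundary_boundary)
      fix \<sigma> assume "\<sigma> \<in> supp d"
      then have \<sigma>: "\<sigma> \<in> K" using d(1) by blast
      show "finite \<sigma>" using \<sigma> V(1) by (auto simp: K intro: finite_subset)
      show "v \<le> w \<or> w \<le> v" if "v \<in> \<sigma>" "w \<in> \<sigma>" for v w
        using \<sigma> that by (simp add: K chain_subset_def)
    qed
    moreover have "supp c \<subseteq> {\<sigma> \<in> K. card \<sigma> = k}"
      unfolding d(2) using d(1) by (rule boundary_in_complex) (rule face_K)
    ultimately show "c \<in> Z" by (simp add: Z)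
  qed
  interpret C: module rat_field C unfolding C_def by (rule module_free_module)
  have subZ: "submodule Z rat_field C"
    unfolding C_def
  proof (rule submodule_free_moduleI)
    show "c + d \<in> Z" if "c \<in> Z" "d \<in> Z" for c d
      using that Poly_Mapping.keys_add[of c d] by (auto simp: Z boundary_eq lin_ext_add)
    show "scale a c \<in> Z" if "c \<in> Z" for a c
      using that keys_scale[of a c] by (auto simp: Z boundary_eq lin_ext_scale)
  qed (auto simp: Z boundary_eq)
  have subB: "submodule B rat_field C"
    unfolding C_def
  proof (rule submodule_free_moduleI)
    show "supp c \<subseteq> {\<sigma> \<in> K. card \<sigma> = k}" if "c \<in> B" for c using that BZ Z by blast
    show "0 \<in> B" unfolding B by (intro exI[of _ 0]) (simp add: boundary_eq)
    show "c + d \<in> B" if cd: "c \<in> B" "d \<in> B" for c d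
    proof -
      obtain c' d' where "supp c' \<subseteq> {\<sigma> \<in> K. card \<sigma> = Suc k}" "c = boundary c'"
        "supp d' \<subseteq> {\<sigma> \<in> K. card \<sigma> = Suc k}" "d = boundary d'" using cd B by blast
      then show ?thesis
        unfolding B using Poly_Mapping.keys_add[of c' d']
        by (intro exI[of _ "c' + d'"]) (auto simp: boundary_eq lin_ext_add)
    qed
    show "scale a c \<in> B" if c: "c \<in> B" for a c
    proof -
      obtain c' where "supp c' \<subseteq> {\<sigma> \<in> K. card \<sigma> = Suc k}" "c = boundary c'" using c B by blast
      then show ?thesis
        unfolding B using keys_scale[of a c']
        by (intro exI[of _ "scale a c'"]) (auto simp: boundary_eq lin_ext_scale)
    qed
  qed
  let ?N = "C\<lparr>carrier := Z\<rparr>"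
  have modN: "module rat_field ?N"
    using subZ C.module_axioms by (rule submodule.submodule_is_module)
  \<comment> \<open>As a submodule of the chains \<open>B\<close> is a module in its own right, and
    lying in \<open>Z\<close> it is a submodule of the cycles.\<close>
  have subBN: "submodule B rat_field ?N"
  proof -
    have "module rat_field (?N\<lparr>carrier := B\<rparr>)"
      using submodule.submodule_is_module[OF subB C.module_axioms] by simp
    then show ?thesis using BZ by (intro module.module_incl_imp_submodule[OF modN]) auto
  qed
  have N: "add ?N = (+)" "module.smult ?N = scale" "carrier ?N = Z"
    by (simp_all add: C_def)
  have M: "carrier (perm_module I) = {u. supp u \<subseteq> permutations_of_set I}"
    "add (perm_module I) = (+)" "module.smult (perm_module I) = scale"
    by (auto simp: perm_module_def carrier_free_module)
  have fZ: "f u \<in> Z" "supp (f u) \<subseteq> odd_chains {} I k" if "supp u \<subseteq> permutations_of_set I" for u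
    using lin_ext_block_cycle_odd_chains[OF I(2) that] unfolding f_def Z odd_K by auto
  have "module_isomorphic rat_field (quotient_module (perm_module I) (relation_submodule I)) (quotient_module ?N B)"
  proof (rule module_isomorphic_quotientI[where f = f])
    show "module rat_field (perm_module I)" unfolding perm_module_def by (rule module_free_module)
    show "submodule (relation_submodule I) rat_field (perm_module I)"
      unfolding perm_module_def by (rule relation_submodule_submodule)
    show "f u \<in> B \<longleftrightarrow> u \<in> relation_submodule I" if "u \<in> carrier (perm_module I)" for u
    proof -
      have u: "supp u \<subseteq> permutations_of_set I" using that M by simp
      \<comment> \<open>The image of \<open>f\<close> is supported on subsets of \<open>I\<close>,
        where no nonzero cycle of this degree bounds, even in the larger complex.\<close>
      have "f u \<in> B \<longleftrightarrow> f u = 0"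
      proof
        assume "f u \<in> B"
        then obtain d where d: "supp d \<subseteq> {\<sigma> \<in> K. card \<sigma> = Suc k}" "f u = boundary d" using B by blast
        have "boundary d = 0"
        proof (rule boundary_in_Pow_zero[OF I])
          fix \<sigma> assume "\<sigma> \<in> supp d"
          then show "chain_subset \<sigma> \<and> card \<sigma> = Suc k \<and> (\<forall>J\<in>\<sigma>. odd (card (J \<inter> I)))"
            using d(1) by (auto simp: K V_def)
        next
          fix \<sigma> assume "\<sigma> \<in> supp (boundary d)"
          then show "\<sigma> \<subseteq> Pow I" using fZ(2)[OF u] unfolding d(2) odd_K by blast
        qed
        then show "f u = 0" using d(2) by simp
      next
        assume "f u = 0"
        then show "f u \<in> B" unfolding B by (intro exI[of _ 0]) (simp add: boundary_eq)
      qed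
      then show ?thesis using relation_submodule_kernel[OF I u] unfolding f_def by simp
    qed
    show "\<exists>u\<in>carrier (perm_module I). \<exists>b\<in>B. c = b \<oplus>\<^bsub>?N\<^esub> f u" if "c \<in> carrier ?N" for c
    proof -
      have c: "boundary c = 0" "supp c \<subseteq> {\<sigma> \<in> {\<sigma>. \<sigma> \<subseteq> V \<and> chain_subset \<sigma>}. card \<sigma> = k}"
        using that by (simp_all only: N(3) Z K)
      \<comment> \<open>Only the move into the subsets of \<open>I\<close> costs a boundary; the
        cycle obtained there is hit by \<open>f\<close> exactly.\<close>
      have "\<exists>d. supp d \<subseteq> {\<sigma> \<in> K. card \<sigma> = Suc k} \<and> boundary (c - boundary d) = 0 \<and>
          supp (c - boundary d) \<subseteq> odd_chains {} I k"
        using homologous_in_Pow[OF V VI c] by (simp only: odd_K K)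
      then obtain d where d: "supp d \<subseteq> {\<sigma> \<in> K. card \<sigma> = Suc k}" "boundary (c - boundary d) = 0"
        "supp (c - boundary d) \<subseteq> odd_chains {} I k"
        by (elim exE conjE)
      obtain u where u: "supp u \<subseteq> permutations_of_set I" "f u = c - boundary d"
        using cycle_in_range[OF I d(2,3)] unfolding f_def by (elim exE conjE)
      have "boundary d \<in> B" using d(1) B by blast
      moreover have "c = boundary d \<oplus>\<^bsub>?N\<^esub> f u" using u(2) by (simp add: N)
      moreover have "u \<in> carrier (perm_module I)" using u(1) by (simp add: M)
      ultimately show ?thesis by (intro bexI)
    qed
  qed (use modN subBN fZ M N in \<open>auto simp: f_def lin_ext_add lin_ext_scale\<close>)
  moreover have "reduced_homology K (int k - 1) = quotient_module ?N B"
    by (simp only: reduced_homology_def chains C_def Z_def B_def)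
  ultimately show ?thesis by (simp only: K_def)
qed

end
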